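(* There exist universal constants $C_1,C_2,C_3>0$ such that the following holds. Let $W$ be an even positive integer, let $K$ be a positive integer with $K\le W$, and let $R$ be a positive integer such that $R$ divides $W$ and $$R\ge C_1 K\log^6 W.$$ Draw an $R\times W$ random demodulator matrix $\Phi$. Then, except with probability at most $C_2W^{-1}$, the following statement holds. For every amplitude vector $s\in\mathbb{C}^W$, every $\eta\ge0$, and every noise vector $\nu\in\mathbb{C}^R$ with $\|\nu\|_2\le\eta$, setting $y=\Phi s+\nu$, every solution $\widehat{s}$ to the convex program $$\min_{v\in\mathbb{C}^W}\ \|v\|_1\quad\text{subject to}\quad\|\Phi v-y\|_2\le\eta$$ satisfies $$\|\widehat{s}-s\|_2\le C_3\max\left\{\eta,\ \frac{1}{\sqrt K}\|s-s_K\|_1\right\},$$ where $s_K$ is a best $K$-sparse approximation to $s$ with respect to the $\ell_1$ norm.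
   Context: $\log$ is the natural logarithm. A vector is $K$-sparse if it has at most $K$ nonzero entries; $s_K$ minimizes $\|s-z\|_1$ over $K$-sparse $z$. Random demodulator matrix (case $R$ divides $W$): $\Phi=HDF\in\mathbb{C}^{R\times W}$, where - $F$ is the $W\times W$ unitary matrix with entries $W^{-1/2}e^{-2\pi i n\omega/W}$, with rows indexed by $n=0,1,\dots,W-1$ and columns by $\omega\in\{0,\pm1,\dots,\pm(W/2-1),W/2\}$ (a permuted discrete Fourier transform matrix); - $D=\mathrm{diag}(\varepsilon_0,\dots,\varepsilon_{W-1})$, where the $\varepsilon_n$ are independent random variables taking the values $\pm1$ with equal probability; - $H$ is the $R\times W$ matrix with 0--1 entries whose $r$th row ($r=0,\dots,R-1$) has $W/R$ consecutive ones starting in column $rW/R+1$ (columns counted from 1), and zeros elsewhere. *)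

theory Defs
  imports "HOL-Probability.Probability" "Jordan_Normal_Form.Matrix"
begin

unbundle no vec_syntax
hide_const (open) Finite_Cartesian_Product.vec Finite_Cartesian_Product.mat
  Finite_Cartesian_Product.row Finite_Cartesian_Product.column

definition l1_norm :: "complex vec \<Rightarrow> real" where
  "l1_norm v = (\<Sum>i<dim_vec v. cmod (v $ i))"

definition l2_norm :: "complex vec \<Rightarrow> real" where
  "l2_norm v = L2_set (\<lambda>i. cmod (v $ i)) {..<dim_vec v}"

definition sparse :: "nat \<Rightarrow> complex vec \<Rightarrow> bool" where
  "sparse K v \<longleftrightarrow> card {i. i < dim_vec v \<and> v $ i \<noteq> 0} \<le> K"

definition best_sparse_approx :: "nat \<Rightarrow> complex vec \<Rightarrow> complex vec \<Rightarrow> bool" where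
  "best_sparse_approx K s sK \<longleftrightarrow>
     is_arg_min (\<lambda>z. l1_norm (s - z)) (\<lambda>z. z \<in> carrier_vec (dim_vec s) \<and> sparse K z) sK"

definition l1_minimizer :: "complex mat \<Rightarrow> complex vec \<Rightarrow> real \<Rightarrow> complex vec \<Rightarrow> bool" where
  "l1_minimizer A y \<eta> v \<longleftrightarrow>
     is_arg_min l1_norm (\<lambda>v. v \<in> carrier_vec (dim_col A) \<and> l2_norm (A *\<^sub>v v - y) \<le> \<eta>) v"

text \<open>For even \<open>W\<close>, the columns \<open>0, \<dots>, W - 1\<close> of the Fourier matrix carry the frequencies
  \<open>-(W/2 - 1), \<dots>, W/2\<close> in increasing order. The order is immaterial below: permuting the
  columns permutes the entries of the coefficient vectors, and norms and sparsity are invariant.\<close>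

definition freq :: "nat \<Rightarrow> nat \<Rightarrow> int" where
  "freq W j = int j - (int (W div 2) - 1)"

definition fourier_mat :: "nat \<Rightarrow> complex mat" where
  "fourier_mat W = mat W W (\<lambda>(n, j).
     exp (- 2 * of_real pi * \<i> * of_nat n * of_int (freq W j) / of_nat W) / of_real (sqrt (real W)))"

definition sign_mat :: "nat \<Rightarrow> (nat \<Rightarrow> real) \<Rightarrow> complex mat" where
  "sign_mat W \<epsilon> = mat_diag W (\<lambda>n. complex_of_real (\<epsilon> n))"

text \<open>Intended for \<open>R dvd W\<close>, where \<open>W div R\<close> is exact; rows and columns are counted from 0.\<close>

definition sampling_mat :: "nat \<Rightarrow> nat \<Rightarrow> complex mat" where
  "sampling_mat R W = mat R W (\<lambda>(r, n).
     if r * (W div R) \<le> n \<and> n < (r + 1) * (W div R) then 1 else 0)"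

definition demodulator_mat :: "nat \<Rightarrow> nat \<Rightarrow> (nat \<Rightarrow> real) \<Rightarrow> complex mat" where
  "demodulator_mat R W \<epsilon> = sampling_mat R W * sign_mat W \<epsilon> * fourier_mat W"

text \<open>Joint law of the independent, uniformly distributed signs \<open>\<epsilon> 0, \<dots>, \<epsilon> (W - 1)\<close>;
  the value 1 at all other indices is an irrelevant default.\<close>

definition sign_pmf :: "nat \<Rightarrow> (nat \<Rightarrow> real) pmf" where
  "sign_pmf W = Pi_pmf {..<W} 1 (\<lambda>_. pmf_of_set {-1, 1})"

end

theory Submission
  imports Defs
begin

text \<open>Sparsity enters the recovery argument only through the set \<open>D\<close> of vectors with \<open>\<ell>\<^sub>2\<close> norm at most
  1 and \<open>\<ell>\<^sub>1\<close> norm at most \<open>4 * sqrt K\<close>: either the error of an \<open>\<ell>\<^sub>1\<close> minimizer is bounded by the \<open>\<ell>\<^sub>1\<close>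
  tail, or it lies in \<open>D\<close> after normalization. It therefore suffices that the supremum \<open>\<Psi>\<close> over \<open>D\<close> of
  the deviation of the squared norm of \<open>\<Phi> x\<close> from that of \<open>x\<close> is at most \<open>3 / 8\<close>.

  The rows of \<open>\<Phi>\<close> depend on disjoint blocks of signs, so the truncated mean of \<open>\<Psi>\<close> is controlled by
  that of the Rademacher process \<open>S\<close> obtained by attaching a sign to every row. Conditionally on rows
  with entries at most \<open>B\<close>, of order \<open>sqrt (ln W / R)\<close>, the increments of this process are subgaussian
  in the maximum norm over the rows, for which Maurey's empirical method yields nets at all dyadic
  scales; chaining over about \<open>log 2 W\<close> scales gives \<open>S \<le> q * sqrt (1 + \<Psi>)\<close> with \<open>q\<close> of order
  \<open>sqrt K * B * (ln W)\<^sup>2\<close> outside a tiny event. For small \<open>q\<close> this bound feeds back into the symmetrization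
  inequality and forces the truncated mean of \<open>\<Psi>\<close> to be tiny.\<close>

section \<open>Exponential moments\<close>

text \<open>Termwise comparison of power series in \<open>x\<^sup>2\<close>:
  \<open>2 ^ n * fact n\<close> is at most \<open>fact (2 * n)\<close>.\<close>

lemma cosh_le_exp_half_square: "cosh x \<le> exp (x\<^sup>2 / 2)" for x :: real
proof -
  have c: "(\<lambda>n. (x^2)^n / fact (2*n)) sums cosh x"
  proof -
    have "(\<lambda>n. if even n then x ^ n /\<^sub>R fact n else 0) sums cosh x"
      by (rule cosh_converges)
    hence "(\<lambda>n. if even (2*n) then x ^ (2*n) /\<^sub>R fact (2*n) else 0) sums cosh x"
      by (subst sums_mono_reindex[of "\<lambda>n. 2*n" "\<lambda>n. if even n then x ^ n /\<^sub>R fact n else 0"])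
         (auto simp: strict_mono_def elim!: evenE)
    thus ?thesis by (simp add: power_mult[of x 2] divide_inverse mult.commute[of "inverse _"])
  qed
  have e: "(\<lambda>n. (x\<^sup>2 / 2)^n /\<^sub>R fact n) sums exp (x\<^sup>2 / 2)"
    by (rule exp_converges)
  have f: "2 ^ n * fact n \<le> (fact (2*n) :: real)" for n
  proof (induction n)
    case (Suc n)
    have "2 ^ Suc n * fact (Suc n) = (2 * (real n + 1)) * (2 ^ n * fact n)" by (simp add: algebra_simps)
    also have "\<dots> \<le> (2 * (real n + 1)) * fact (2 * n)" by (rule mult_left_mono[OF Suc]) auto
    also have "\<dots> \<le> ((2 * real n + 2) * (2 * real n + 1)) * fact (2 * n)"
      by (intro mult_right_mono) (auto simp: algebra_simps)
    also have "\<dots> = fact (2 * Suc n)" by (simp add: algebra_simps)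
    finally show ?case .
  qed simp
  show ?thesis
  proof (rule sums_le[OF _ c e])
    fix n
    have "(x^2)^n / fact (2*n) \<le> (x^2)^n / (2 ^ n * fact n)"
      by (rule divide_left_mono[OF f]) auto
    thus "(x^2)^n / fact (2*n) \<le> (x\<^sup>2 / 2)^n /\<^sub>R fact n" 
      by (simp add: power_divide field_simps)
  qed
qed

text \<open>By convexity the exponential lies below its chord between \<open>- (t * c)\<close> and
  \<open>t * c\<close>. In terms of \<open>cosh\<close> and \<open>sinh\<close> this chord is affine
  in \<open>y\<close>, so averaging over a centred variable leaves only the \<open>cosh\<close>
  term.\<close>

lemma exp_le_secant:
  fixes y c t :: real
  assumes "\<bar>y\<bar> \<le> c" "c > 0"
  shows "exp (t * y) \<le> cosh (t * c) + y / c * sinh (t * c)"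
proof -
  define u where "u = (1 + y / c) / 2"
  have u: "0 \<le> u" "u \<le> 1" using assms by (auto simp: u_def field_simps abs_le_iff)
  have "exp ((1 - u) * (- (t * c)) + u * (t * c)) \<le> (1 - u) * exp (- (t * c)) + u * exp (t * c)"
    using convex_onD[OF convex_on_exp[of 1], of u "- (t*c)" "t * c"] u by auto
  also have "(1 - u) * (- (t * c)) + u * (t * c) = t * y"
    using assms by (simp add: u_def field_simps)
  also have "(1 - u) * exp (- (t * c)) + u * exp (t * c) = cosh (t * c) + y / c * sinh (t * c)"
    using assms by (simp add: u_def cosh_def sinh_def field_simps)
  finally show ?thesis .
qed

text \<open>Hoeffding's lemma for a finite distribution: in the averaged secant bound the
  \<open>sinh\<close> term vanishes because the mean is zero.\<close>

lemma weighted_exp_le: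
  fixes w y :: "'a \<Rightarrow> real"
  assumes "finite A" "\<And>a. a \<in> A \<Longrightarrow> w a \<ge> 0" "(\<Sum>a\<in>A. w a) = 1" "(\<Sum>a\<in>A. w a * y a) = 0"
    and c: "\<And>a. a \<in> A \<Longrightarrow> \<bar>y a\<bar> \<le> c" "c > 0"
  shows "(\<Sum>a\<in>A. w a * exp (t * y a)) \<le> exp (t\<^sup>2 * c\<^sup>2 / 2)"
proof -
  have "(\<Sum>a\<in>A. w a * exp (t * y a)) \<le> (\<Sum>a\<in>A. w a * (cosh (t * c) + y a / c * sinh (t * c)))"
    by (intro sum_mono mult_left_mono exp_le_secant assms)
  also have "\<dots> = (\<Sum>a\<in>A. w a) * cosh (t * c) + (\<Sum>a\<in>A. w a * y a) / c * sinh (t * c)"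
    by (simp add: sum.distrib sum_distrib_right sum_divide_distrib distrib_left mult.assoc)
  also have "\<dots> \<le> exp ((t * c)\<^sup>2 / 2)" using assms cosh_le_exp_half_square by simp
  finally show ?thesis by (simp add: power_mult_distrib)
qed

section \<open>Uniform random signs and Hoeffding's inequality\<close>

definition signs :: "nat \<Rightarrow> (nat \<Rightarrow> real) set" where
  "signs n = PiE_dflt {..<n} 1 (\<lambda>_. {-1, 1})"

lemma finite_signs [simp]: "finite (signs n)"
  by (auto simp: signs_def)

lemma card_signs [simp]: "card (signs n) = 2 ^ n"
  by (simp add: signs_def card_PiE_dflt numeral_2_eq_2)

lemma signs_nonempty [simp]: "signs n \<noteq> {}"
  by (simp add: signs_def)

text \<open>The law of the signs is uniform on a finite set, so expectations become finite sums over
  \<open>signs n\<close> and probabilities become cardinalities divided by \<open>2 ^ n\<close>. The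
  default value 1 agrees with that of \<open>sign_pmf\<close>.\<close>

lemma sign_pmf_eq: "sign_pmf n = pmf_of_set (signs n)"
  by (simp add: sign_pmf_def signs_def Pi_pmf_of_set)

lemma signs_iff: "\<sigma> \<in> signs n \<longleftrightarrow> (\<forall>i<n. \<sigma> i = 1 \<or> \<sigma> i = -1) \<and> (\<forall>i\<ge>n. \<sigma> i = 1)"
  unfolding signs_def PiE_dflt_def mem_Collect_eq not_less[symmetric] insert_iff lessThan_iff empty_iff by blast

lemma signs_cases: "\<sigma> \<in> signs n \<Longrightarrow> \<sigma> i = 1 \<or> \<sigma> i = -1"
  unfolding signs_iff by (cases "i < n") auto

lemma sum_signs_exp:
  "(\<Sum>\<sigma>\<in>signs n. exp (t * (\<Sum>i<n. \<sigma> i * a i))) = 2 ^ n * (\<Prod>i<n. cosh (t * a i))"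
proof -
  have "measure_pmf.expectation (sign_pmf n) (\<lambda>\<sigma>. \<Prod>i<n. exp (t * (\<sigma> i * a i)))
     = (\<Prod>i<n. measure_pmf.expectation (pmf_of_set {-1, 1}) (\<lambda>v. exp (t * (v * a i))))"
    unfolding sign_pmf_def
    by (intro expectation_prod_Pi_pmf integrable_measure_pmf_finite) auto
  also have "\<dots> = (\<Prod>i<n. cosh (t * a i))"
    by (intro prod.cong) (auto simp: integral_pmf_of_set cosh_def)
  also have "(\<lambda>\<sigma>. \<Prod>i<n. exp (t * (\<sigma> i * a i))) = (\<lambda>\<sigma>. exp (t * (\<Sum>i<n. \<sigma> i * a i)))"
    by (simp add: exp_sum sum_distrib_left)
  finally show ?thesis
    by (simp add: sign_pmf_eq integral_pmf_of_set divide_eq_eq mult.commute)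
qed

lemma sum_signs_exp_le:
  "(\<Sum>\<sigma>\<in>signs n. exp (t * (\<Sum>i<n. \<sigma> i * a i))) \<le> 2 ^ n * exp (t\<^sup>2 * (\<Sum>i<n. (a i)\<^sup>2) / 2)"
proof -
  have "(\<Prod>i<n. cosh (t * a i)) \<le> (\<Prod>i<n. exp ((t * a i)\<^sup>2 / 2))"
    by (intro prod_mono) (auto simp: cosh_le_exp_half_square)
  also have "\<dots> = exp (t\<^sup>2 * (\<Sum>i<n. (a i)\<^sup>2) / 2)"
    by (simp add: exp_sum sum_distrib_left power_mult_distrib sum_divide_distrib)
  finally show ?thesis by (simp add: sum_signs_exp)
qed

text \<open>Hoeffding's inequality as a count. The Chernoff bound is applied to the sum and to its
  negative, whence the factor 2.\<close>

lemma rademacher_tail: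
  assumes "(\<Sum>i<n. (a i)\<^sup>2) \<le> v" "v > 0" "u \<ge> 0"
  shows "real (card {\<sigma> \<in> signs n. \<bar>\<Sum>i<n. \<sigma> i * a i\<bar> > u}) \<le> 2 * exp (- u\<^sup>2 / (2 * v)) * 2 ^ n"
proof -
  \<comment> \<open>This value minimizes the Chernoff exponent
    \<open>t\<^sup>2 * v / 2 - t * u\<close>; the minimum is
    \<open>- u\<^sup>2 / (2 * v)\<close>.\<close>
  define t where "t = u / v"
  have t: "t \<ge> 0" using assms by (simp add: t_def)
  let ?S = "\<lambda>\<sigma>::nat\<Rightarrow>real. \<Sum>i<n. \<sigma> i * a i"
  have "real (card {\<sigma> \<in> signs n. \<bar>?S \<sigma>\<bar> > u}) * exp (t * u) = (\<Sum>\<sigma>\<in>{\<sigma> \<in> signs n. \<bar>?S \<sigma>\<bar> > u}. exp (t * u))"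
    by simp
  also have "\<dots> \<le> (\<Sum>\<sigma>\<in>{\<sigma> \<in> signs n. \<bar>?S \<sigma>\<bar> > u}. exp (t * ?S \<sigma>) + exp ((-t) * ?S \<sigma>))"
  proof (intro sum_mono)
    fix \<sigma> assume "\<sigma> \<in> {\<sigma> \<in> signs n. \<bar>?S \<sigma>\<bar> > u}"
    hence "u \<le> ?S \<sigma> \<or> u \<le> - ?S \<sigma>" by auto
    hence "t * u \<le> t * ?S \<sigma> \<or> t * u \<le> t * (- ?S \<sigma>)" using t mult_left_mono by blast
    hence "exp (t * u) \<le> exp (t * ?S \<sigma>) \<or> exp (t * u) \<le> exp ((-t) * ?S \<sigma>)" by simp
    thus "exp (t * u) \<le> exp (t * ?S \<sigma>) + exp ((-t) * ?S \<sigma>)"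
      by (smt (verit) exp_ge_zero)
  qed
  also have "\<dots> \<le> (\<Sum>\<sigma>\<in>signs n. exp (t * ?S \<sigma>) + exp ((-t) * ?S \<sigma>))"
    by (intro sum_mono2) (auto intro: add_nonneg_nonneg)
  also have "\<dots> = (\<Sum>\<sigma>\<in>signs n. exp (t * ?S \<sigma>)) + (\<Sum>\<sigma>\<in>signs n. exp ((-t) * ?S \<sigma>))"
    by (rule sum.distrib)
  also have "\<dots> \<le> 2 ^ n * exp (t\<^sup>2 * (\<Sum>i<n. (a i)\<^sup>2) / 2) + 2 ^ n * exp ((-t)\<^sup>2 * (\<Sum>i<n. (a i)\<^sup>2) / 2)"
    by (intro add_mono sum_signs_exp_le)
  also have "\<dots> \<le> 2 * exp (t\<^sup>2 * v / 2) * 2 ^ n"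
    using assms by (simp add: mult_left_mono)
  also have "exp (t\<^sup>2 * v / 2) = exp (- u\<^sup>2 / (2 * v)) * exp (t * u)"
    using assms unfolding exp_add[symmetric] by (simp add: t_def power2_eq_square field_simps)
  finally show ?thesis by (simp add: mult_ac)
qed

section \<open>Maurey's empirical method\<close>

text \<open>The potential on the left is a sum of exponential moments; sampling one more atom multiplies
  its average by at most \<open>exp (t\<^sup>2 c\<^sup>2 / 2)\<close>, so some atom does at least as well.\<close>

lemma empirical_potential:
  fixes g :: "'r \<Rightarrow> 'a \<Rightarrow> real"
  assumes A: "finite A" "\<And>a. a \<in> A \<Longrightarrow> w a \<ge> 0" "(\<Sum>a\<in>A. w a) = 1"
    and I: "finite I"
    and m: "\<And>r. r \<in> I \<Longrightarrow> (\<Sum>a\<in>A. w a * g r a) = m r"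
    and c: "\<And>r a. r \<in> I \<Longrightarrow> a \<in> A \<Longrightarrow> \<bar>g r a - m r\<bar> \<le> c" "c > 0"
  shows "\<exists>xs. length xs = k \<and> set xs \<subseteq> A \<and>
     (\<Sum>r\<in>I. exp (t * (\<Sum>a\<leftarrow>xs. g r a - m r)) + exp ((-t) * (\<Sum>a\<leftarrow>xs. g r a - m r)))
       \<le> 2 * real (card I) * exp (t\<^sup>2 * c\<^sup>2 / 2) ^ k"
proof (induction k)
  case 0
  show ?case by (intro exI[of _ "[]"]) simp
next
  case (Suc k)
  define e where "e = exp (t\<^sup>2 * c\<^sup>2 / 2)"
  define P where "P xs = (\<Sum>r\<in>I. exp (t * (\<Sum>a\<leftarrow>xs. g r a - m r)) + exp ((-t) * (\<Sum>a\<leftarrow>xs. g r a - m r)))" for xs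
  obtain xs where xs: "length xs = k" "set xs \<subseteq> A" "P xs \<le> 2 * real (card I) * e ^ k"
    using Suc unfolding P_def e_def by blast
  have mean: "(\<Sum>a\<in>A. w a * (g r a - m r)) = 0" if "r \<in> I" for r
    using m[OF that] A(3) by (simp add: algebra_simps sum_subtractf flip: sum_distrib_left)
  have "(\<Sum>a\<in>A. w a * P (a # xs)) =
     (\<Sum>r\<in>I. (\<Sum>a\<in>A. w a * exp (t * (g r a - m r))) * exp (t * (\<Sum>a\<leftarrow>xs. g r a - m r))
          + (\<Sum>a\<in>A. w a * exp ((-t) * (g r a - m r))) * exp ((-t) * (\<Sum>a\<leftarrow>xs. g r a - m r)))"
    unfolding P_def sum_distrib_left
    by (subst sum.swap)
       (simp only: list.map sum_list.Cons exp_add distrib_left sum.distrib sum_distrib_right mult.assoc)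
  also have "\<dots> \<le> (\<Sum>r\<in>I. e * exp (t * (\<Sum>a\<leftarrow>xs. g r a - m r)) + e * exp ((-t) * (\<Sum>a\<leftarrow>xs. g r a - m r)))"
  proof (intro sum_mono add_mono mult_right_mono)
    fix r assume r: "r \<in> I"
    show "(\<Sum>a\<in>A. w a * exp (t * (g r a - m r))) \<le> e"
      unfolding e_def by (rule weighted_exp_le) (use A c r mean in auto)
    have "(\<Sum>a\<in>A. w a * exp ((-t) * (g r a - m r))) \<le> exp ((-t)\<^sup>2 * c\<^sup>2 / 2)"
      by (rule weighted_exp_le) (use A c r mean in auto)
    thus "(\<Sum>a\<in>A. w a * exp ((-t) * (g r a - m r))) \<le> e" by (simp add: e_def)
  qed auto
  also have "\<dots> = e * P xs" by (simp add: P_def sum_distrib_left algebra_simps)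
  finally have avg: "(\<Sum>a\<in>A. w a * P (a # xs)) \<le> e * P xs" .
  \<comment> \<open>A weighted average cannot be smaller than all its terms. The strict inequality
    behind the contradiction comes from an atom of positive weight, which exists since the weights
    add up to 1.\<close>
  have "\<exists>a\<in>A. P (a # xs) \<le> e * P xs"
  proof (rule ccontr)
    assume "\<not> ?thesis"
    hence gt: "P (a # xs) > e * P xs" if "a \<in> A" for a using that by force
    have "\<exists>a\<in>A. w a > 0"
    proof (rule ccontr)
      assume "\<not> ?thesis"
      hence "(\<Sum>a\<in>A. w a) \<le> 0" by (intro sum_nonpos) force
      thus False using A by simp
    qed
    then obtain a0 where a0: "a0 \<in> A" "w a0 > 0" by auto
    have "(\<Sum>a\<in>A. w a * (e * P xs)) < (\<Sum>a\<in>A. w a * P (a # xs))"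
    proof (rule sum_strict_mono_ex1)
      show "\<forall>a\<in>A. w a * (e * P xs) \<le> w a * P (a # xs)"
        using gt A by (intro ballI mult_left_mono) (auto intro: less_imp_le)
      show "\<exists>a\<in>A. w a * (e * P xs) < w a * P (a # xs)"
        using a0 gt by (intro bexI[of _ a0] mult_strict_left_mono) auto
    qed (rule A)
    also have "(\<Sum>a\<in>A. w a * (e * P xs)) = e * P xs" 
      by (simp add: A(3) flip: sum_distrib_right)
    finally show False using avg by simp
  qed
  then obtain a where a: "a \<in> A" "P (a # xs) \<le> e * P xs" by blast
  have "P (a # xs) \<le> e * (2 * real (card I) * e ^ k)"
    using a(2) mult_left_mono[OF xs(3), of e] by (rule order_trans) (simp add: e_def)
  thus ?case unfolding P_def[symmetric] e_def[symmetric]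
    by (intro exI[of _ "a # xs"]) (use a xs in \<open>auto simp: mult_ac\<close>)
qed

text \<open>A single coordinate that is off by more than \<open>u\<close> pushes one term of the
  potential above \<open>exp (t * (k * u))\<close>. For \<open>t = u / c\<^sup>2\<close> the bound
  of \<open>empirical_potential\<close> is \<open>2 * card I\<close> times the square root of that
  number, and the condition on \<open>k\<close> makes this too small.\<close>

lemma maurey_empirical:
  fixes g :: "'r \<Rightarrow> 'a \<Rightarrow> real"
  assumes A: "finite A" "\<And>a. a \<in> A \<Longrightarrow> w a \<ge> 0" "(\<Sum>a\<in>A. w a) = 1"
    and I: "finite I"
    and m: "\<And>r. r \<in> I \<Longrightarrow> (\<Sum>a\<in>A. w a * g r a) = m r"
    and c: "\<And>r a. r \<in> I \<Longrightarrow> a \<in> A \<Longrightarrow> \<bar>g r a - m r\<bar> \<le> c" "c > 0"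
    and k: "k > 0" "u > 0" "2 * real (card I) < exp (real k * u\<^sup>2 / (2 * c\<^sup>2))"
  shows "\<exists>xs. length xs = k \<and> set xs \<subseteq> A \<and> (\<forall>r\<in>I. \<bar>(\<Sum>a\<leftarrow>xs. g r a) / real k - m r\<bar> \<le> u)"
proof -
  define t where "t = u / c\<^sup>2"
  have t: "t > 0" using c k by (simp add: t_def)
  obtain xs where xs: "length xs = k" "set xs \<subseteq> A"
    "(\<Sum>r\<in>I. exp (t * (\<Sum>a\<leftarrow>xs. g r a - m r)) + exp ((-t) * (\<Sum>a\<leftarrow>xs. g r a - m r)))
       \<le> 2 * real (card I) * exp (t\<^sup>2 * c\<^sup>2 / 2) ^ k"
    using empirical_potential[of A w I g m c k t, OF A I m c] by blast
  have eq: "exp (t\<^sup>2 * c\<^sup>2 / 2) ^ k = exp (real k * (u\<^sup>2 / (2 * c\<^sup>2)))"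
    using c by (simp add: exp_of_nat_mult[symmetric] t_def power2_eq_square field_simps)
  have "\<bar>(\<Sum>a\<leftarrow>xs. g r a) / real k - m r\<bar> \<le> u" if r: "r \<in> I" for r
  proof (rule ccontr)
    assume n: "\<not> ?thesis"
    let ?s = "\<Sum>a\<leftarrow>xs. g r a - m r"
    have s: "?s = (\<Sum>a\<leftarrow>xs. g r a) - real k * m r"
      using xs(1) by (simp add: sum_list_subtractf sum_list_triv)
    have "?s = real k * ((\<Sum>a\<leftarrow>xs. g r a) / real k - m r)"
      using k by (simp add: s right_diff_distrib)
    hence "\<bar>?s\<bar> = real k * \<bar>(\<Sum>a\<leftarrow>xs. g r a) / real k - m r\<bar>"
      by (simp add: abs_mult)
    hence "\<bar>?s\<bar> > real k * u" using n k by simp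
    hence "t * \<bar>?s\<bar> > t * (real k * u)" using t by simp
    hence "exp (t * (real k * u)) < exp (t * \<bar>?s\<bar>)" by simp
    also have "exp (t * \<bar>?s\<bar>) \<le> exp (t * ?s) + exp ((-t) * ?s)" by (cases "?s \<ge> 0") auto
    also have "\<dots> \<le> (\<Sum>r\<in>I. exp (t * (\<Sum>a\<leftarrow>xs. g r a - m r)) + exp ((-t) * (\<Sum>a\<leftarrow>xs. g r a - m r)))"
      by (rule member_le_sum[OF r]) (use I in \<open>auto intro: add_nonneg_nonneg\<close>)
    also have "\<dots> \<le> 2 * real (card I) * exp (real k * (u\<^sup>2 / (2 * c\<^sup>2)))" using xs(3) eq by simp
    also have "\<dots> < exp (real k * u\<^sup>2 / (2 * c\<^sup>2)) * exp (real k * (u\<^sup>2 / (2 * c\<^sup>2)))"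
      by (rule mult_strict_right_mono[OF k(3)]) simp
    also have "\<dots> = exp (t * (real k * u))"
      unfolding exp_add[symmetric] using c by (simp add: t_def power2_eq_square field_simps)
    finally show False by simp
  qed
  thus ?thesis using xs by blast
qed

text \<open>A vector of l1 norm at most \<open>s\<close> is a convex combination of signed unit
  vectors scaled by \<open>s\<close>, so its images under the rows \<open>a r\<close> are means of
  the atoms \<open>s * \<theta> * a r j\<close>. Atoms and means are at most \<open>s * B\<close> in
  absolute value, so deviations are at most \<open>2 * s * B\<close>.\<close>

lemma maurey_l1:
  fixes x :: "'j \<Rightarrow> real" and a :: "'r \<Rightarrow> 'j \<Rightarrow> real"
  assumes J: "finite J" "J \<noteq> {}" and x: "(\<Sum>j\<in>J. \<bar>x j\<bar>) \<le> s" and s: "s > 0"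
    and a: "\<And>r j. r \<in> I \<Longrightarrow> j \<in> J \<Longrightarrow> \<bar>a r j\<bar> \<le> B" and B: "B > 0"
    and I: "finite I"
    and k: "k > 0" "u > 0" "2 * real (card I) < exp (real k * u\<^sup>2 / (8 * s\<^sup>2 * B\<^sup>2))"
  shows "\<exists>xs. length xs = k \<and> set xs \<subseteq> J \<times> {1, -1} \<and>
     (\<forall>r\<in>I. \<bar>(\<Sum>(j, \<theta>)\<leftarrow>xs. s * \<theta> * a r j) / real k - (\<Sum>j\<in>J. a r j * x j)\<bar> \<le> u)"
proof -
  define X where "X = (\<Sum>j\<in>J. \<bar>x j\<bar>)"
  \<comment> \<open>The natural weights add up to \<open>X / s\<close>, which may be less than 1.
    The deficit is shared equally among all \<open>2 * card J\<close> atoms; equal shares at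
    opposite signs cancel in the mean.\<close>
  define q where "q = (1 - X / s) / (2 * real (card J))"
  define w :: "'j \<times> real \<Rightarrow> real" where "w = (\<lambda>(j, \<theta>). (\<bar>x j\<bar> + \<theta> * x j) / (2 * s) + q)"
  define g :: "'r \<Rightarrow> 'j \<times> real \<Rightarrow> real" where "g = (\<lambda>r (j, \<theta>). s * \<theta> * a r j)"
  define m where "m r = (\<Sum>j\<in>J. a r j * x j)" for r
  have cJ: "real (card J) > 0" using J by (simp add: card_gt_0_iff)
  have sum2: "(\<Sum>p\<in>J \<times> {1, -1}. f p) = (\<Sum>j\<in>J. f (j, 1) + f (j, -1))" for f :: "'j \<times> real \<Rightarrow> real"
    by (simp add: sum.cartesian_product[symmetric, of "\<lambda>a b. f (a, b)", simplified])
  have q: "q \<ge> 0" using x s cJ by (simp add: q_def X_def)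
  have w1: "w (j, 1) + w (j, -1) = \<bar>x j\<bar> / s + 2 * q" for j
    using s by (simp add: w_def field_simps)
  have w2: "w (j, 1) - w (j, -1) = x j / s" for j
    using s by (simp add: w_def field_simps)
  have mr: "(\<Sum>p\<in>J \<times> {1, -1}. w p * g r p) = m r" for r
  proof -
    have "w (j, 1) * g r (j, 1) + w (j, -1) * g r (j, -1) = a r j * x j" for j
    proof -
      have "w (j, 1) * g r (j, 1) + w (j, -1) * g r (j, -1) = s * a r j * (w (j, 1) - w (j, -1))"
        by (simp add: g_def algebra_simps)
      also have "\<dots> = a r j * x j" unfolding w2 using s by simp
      finally show ?thesis .
    qed
    thus ?thesis by (simp add: sum2 m_def)
  qed
  have "\<exists>xs. length xs = k \<and> set xs \<subseteq> J \<times> {1, -1} \<and>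
     (\<forall>r\<in>I. \<bar>(\<Sum>p\<leftarrow>xs. g r p) / real k - m r\<bar> \<le> u)"
  proof (rule maurey_empirical[where w = w and c = "2 * s * B"])
    show "finite (J \<times> {1, - 1 :: real})" using J by simp
    fix p assume "p \<in> J \<times> {1, - 1 :: real}"
    then obtain j \<theta> where p: "p = (j, \<theta>)" "j \<in> J" "\<theta> = 1 \<or> \<theta> = -1" by auto
    have "\<bar>x j\<bar> + \<theta> * x j \<ge> 0" using p by auto
    thus "w p \<ge> 0" using s q p by (simp add: w_def)
  next
    have "(\<Sum>p\<in>J \<times> {1, -1}. w p) = (\<Sum>j\<in>J. \<bar>x j\<bar> / s + 2 * q)" by (simp only: sum2 w1)
    also have "\<dots> = X / s + 2 * q * real (card J)" 
      by (simp add: sum.distrib X_def sum_divide_distrib)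
    also have "2 * q * real (card J) = 1 - X / s" using cJ by (simp add: q_def)
    also have "X / s + (1 - X / s) = 1" by simp
    finally show "(\<Sum>p\<in>J \<times> {1, -1}. w p) = 1" .
  next
    fix r p assume r: "r \<in> I" and "p \<in> J \<times> {1, - 1 :: real}"
    then obtain j \<theta> where p: "p = (j, \<theta>)" "j \<in> J" "\<theta> = 1 \<or> \<theta> = -1" by auto
    have "\<bar>g r p\<bar> = s * \<bar>a r j\<bar>" using p s by (auto simp: g_def abs_mult)
    hence 1: "\<bar>g r p\<bar> \<le> s * B" using a[OF r p(2)] s by simp
    have "\<bar>m r\<bar> \<le> (\<Sum>j\<in>J. \<bar>a r j * x j\<bar>)" unfolding m_def by (rule sum_abs)
    also have "\<dots> \<le> (\<Sum>j\<in>J. B * \<bar>x j\<bar>)"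
      unfolding abs_mult by (intro sum_mono mult_right_mono a r) auto
    also have "\<dots> \<le> B * s" using x B by (simp flip: sum_distrib_left)
    finally show "\<bar>g r p - m r\<bar> \<le> 2 * s * B" using 1 by (simp add: mult.commute)
  next
    have "2 * (2 * s * B)\<^sup>2 = 8 * s\<^sup>2 * B\<^sup>2" by (simp add: power2_eq_square)
    thus "2 * real (card I) < exp (real k * u\<^sup>2 / (2 * (2 * s * B)\<^sup>2))" using k(3) by (simp only:)
  qed (use I mr s B k in auto)
  thus ?thesis by (simp add: g_def m_def)
qed

text \<open>A point of \<open>D\<close> is encoded by a list of \<open>k\<close> signed atoms whose
  average approximates all its row images at once; counting lists bounds the net. Since such an
  average need not come from a point of \<open>D\<close>, the net consists of one representative in
  \<open>D\<close> for every code that occurs.\<close>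

lemma l1_net:
  fixes \<phi> :: "nat \<Rightarrow> nat \<Rightarrow> complex" and D :: "(nat \<Rightarrow> complex) set"
  assumes D: "\<And>x. x \<in> D \<Longrightarrow> (\<Sum>i<W. cmod (x i)) \<le> s" and s: "s > 0" and W: "W > 0"
    and B: "\<And>r i. r < R \<Longrightarrow> i < W \<Longrightarrow> cmod (\<phi> r i) \<le> B" "B > 0"
    and k: "k > 0" "d > 0" "4 * real R < exp (real k * d\<^sup>2 / (512 * s\<^sup>2 * B\<^sup>2))"
  shows "\<exists>\<pi>. \<pi> ` D \<subseteq> D \<and> finite (\<pi> ` D) \<and> card (\<pi> ` D) \<le> (4 * W) ^ k \<and>
     (\<forall>x\<in>D. \<forall>r<R. cmod ((\<Sum>i<W. \<phi> r i * x i) - (\<Sum>i<W. \<phi> r i * \<pi> x i)) \<le> d)"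
proof -
  \<comment> \<open>The Boolean selects the real or the imaginary part, which turns complex rows and
    vectors into real ones of twice the size. The l1 norm at most doubles, hence the radius
    \<open>2 * s\<close> below, and there are \<open>2 * (2 * W)\<close> signed atoms.\<close>
  define J :: "(nat \<times> bool) set" where "J = {..<W} \<times> UNIV"
  define I :: "(nat \<times> bool) set" where "I = {..<R} \<times> UNIV"
  define y :: "(nat \<Rightarrow> complex) \<Rightarrow> nat \<times> bool \<Rightarrow> real"
    where "y = (\<lambda>x (i, b). if b then Re (x i) else Im (x i))"
  define a :: "nat \<times> bool \<Rightarrow> nat \<times> bool \<Rightarrow> real"
    where "a = (\<lambda>(r, p) (i, b). if p then (if b then Re (\<phi> r i) else - Im (\<phi> r i))
                                 else (if b then Im (\<phi> r i) else Re (\<phi> r i)))"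
  define L where "L r x = (\<Sum>i<W. \<phi> r i * x i)" for r and x :: "nat \<Rightarrow> complex"
  define v where "v \<rho> xs = (\<Sum>(j, \<theta>)\<leftarrow>xs. 2 * s * \<theta> * a \<rho> j) / real k" for \<rho> and xs :: "((nat \<times> bool) \<times> real) list"
  define C :: "((nat \<times> bool) \<times> real) list set"
    where "C = {xs. set xs \<subseteq> J \<times> {1, -1} \<and> length xs = k}"
  have sumJ: "(\<Sum>j\<in>J. f j) = (\<Sum>i<W. f (i, True) + f (i, False))" for f :: "nat \<times> bool \<Rightarrow> real"
    unfolding J_def by (simp add: sum.cartesian_product[symmetric, of "\<lambda>a b. f (a, b)", simplified] UNIV_bool add.commute)
  have LRe: "(\<Sum>j\<in>J. a (r, True) j * y x j) = Re (L r x)" for r x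
    by (simp add: sumJ a_def y_def L_def)
  have LIm: "(\<Sum>j\<in>J. a (r, False) j * y x j) = Im (L r x)" for r x
    by (simp add: sumJ a_def y_def L_def add.commute)
  have "\<exists>xs\<in>C. \<forall>\<rho>\<in>I. \<bar>v \<rho> xs - (\<Sum>j\<in>J. a \<rho> j * y x j)\<bar> \<le> d / 4" if x: "x \<in> D" for x
  proof -
    have "\<exists>xs. length xs = k \<and> set xs \<subseteq> J \<times> {1, -1} \<and>
       (\<forall>\<rho>\<in>I. \<bar>(\<Sum>(j, \<theta>)\<leftarrow>xs. (2 * s) * \<theta> * a \<rho> j) / real k - (\<Sum>j\<in>J. a \<rho> j * y x j)\<bar> \<le> d / 4)"
    proof (rule maurey_l1[where B = B])
      have "(\<Sum>j\<in>J. \<bar>y x j\<bar>) = (\<Sum>i<W. \<bar>Re (x i)\<bar> + \<bar>Im (x i)\<bar>)" by (simp add: sumJ y_def)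
      also have "\<dots> \<le> (\<Sum>i<W. cmod (x i) + cmod (x i))"
        by (intro sum_mono add_mono abs_Re_le_cmod abs_Im_le_cmod)
      also have "\<dots> \<le> 2 * s" using D[OF x] unfolding sum.distrib by linarith
      finally show "(\<Sum>j\<in>J. \<bar>y x j\<bar>) \<le> 2 * s" .
      show "\<bar>a \<rho> j\<bar> \<le> B" if "\<rho> \<in> I" "j \<in> J" for \<rho> j
      proof -
        obtain r p i b where e: "\<rho> = (r, p)" "j = (i, b)" by (metis surj_pair)
        with that have "cmod (\<phi> r i) \<le> B" by (intro B) (auto simp: I_def J_def)
        thus ?thesis using abs_Re_le_cmod[of "\<phi> r i"] abs_Im_le_cmod[of "\<phi> r i"]
          by (simp add: e a_def)
      qed
      have "real (card I) = 2 * real R" by (simp add: I_def)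
      moreover have "real k * (d / 4)\<^sup>2 / (8 * (2 * s)\<^sup>2 * B\<^sup>2) = real k * d\<^sup>2 / (512 * s\<^sup>2 * B\<^sup>2)"
        by (simp add: power2_eq_square)
      ultimately show "2 * real (card I) < exp (real k * (d / 4)\<^sup>2 / (8 * (2 * s)\<^sup>2 * B\<^sup>2))"
        using k(3) by simp
    qed (use W s B k in \<open>auto simp: I_def J_def\<close>)
    thus ?thesis by (auto simp: C_def v_def)
  qed
  then obtain code where code: "\<And>x. x \<in> D \<Longrightarrow> code x \<in> C"
    "\<And>x \<rho>. x \<in> D \<Longrightarrow> \<rho> \<in> I \<Longrightarrow> \<bar>v \<rho> (code x) - (\<Sum>j\<in>J. a \<rho> j * y x j)\<bar> \<le> d / 4"
    by metis
  define rep where "rep c = (SOME z. z \<in> D \<and> code z = c)" for c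
  define \<pi> where "\<pi> x = rep (code x)" for x
  have \<pi>: "\<pi> x \<in> D \<and> code (\<pi> x) = code x" if "x \<in> D" for x
    unfolding \<pi>_def rep_def by (rule someI[of _ x]) (use that in auto)
  have C: "finite C" "card C = (4 * W) ^ k"
    unfolding C_def by (auto simp: finite_lists_length_eq card_lists_length_eq J_def card_cartesian_product)
  have sub: "code ` D \<subseteq> C" using code by auto
  have im: "\<pi> ` D = rep ` code ` D" by (simp add: \<pi>_def image_image)
  have "finite (code ` D)" using sub C finite_subset by blast
  hence "finite (\<pi> ` D)" "card (\<pi> ` D) \<le> card (code ` D)" unfolding im by (auto intro: card_image_le)
  moreover have "card (code ` D) \<le> (4 * W) ^ k" using card_mono[OF C(1) sub] C(2) by simp
  moreover have "cmod (L r x - L r (\<pi> x)) \<le> d" if x: "x \<in> D" and r: "r < R" for x r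
  proof -
    have rI: "(r, p) \<in> I" for p using r by (simp add: I_def)
    \<comment> \<open>Two points with the same code are both \<open>d / 4\<close>-close to one
      average. Their real parts and their imaginary parts then differ by at most
      \<open>d / 2\<close> each, and the complex values by at most \<open>d\<close>.\<close>
    have tri: "\<bar>q - q'\<bar> \<le> d / 2" if "\<bar>p - q\<bar> \<le> d / 4" "\<bar>p - q'\<bar> \<le> d / 4" for p q q' :: real
      using that by linarith
    have "\<bar>Re (L r x - L r (\<pi> x))\<bar> \<le> d / 2"
      using tri[OF code(2)[OF x rI[of True]]] code(2)[of "\<pi> x", OF _ rI[of True]] \<pi>[OF x]
      unfolding LRe minus_complex.simps by metis
    moreover have "\<bar>Im (L r x - L r (\<pi> x))\<bar> \<le> d / 2"
      using tri[OF code(2)[OF x rI[of False]]] code(2)[of "\<pi> x", OF _ rI[of False]] \<pi>[OF x]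
      unfolding LIm minus_complex.simps by metis
    ultimately show ?thesis using cmod_le[of "L r x - L r (\<pi> x)"] by linarith
  qed
  ultimately show ?thesis using \<pi> unfolding L_def
    by (intro exI[of _ \<pi>]) auto
qed

section \<open>Chaining\<close>

text \<open>A difference of squares factors: the difference of the moduli is controlled by
  \<open>d\<close> in every row, and their sum only needs an l2 bound. This is why the maximum norm
  over the rows is the right metric for the increments.\<close>

lemma sum_square_norm_diff_le:
  fixes f g :: "nat \<Rightarrow> complex"
  assumes d: "\<And>r. r < R \<Longrightarrow> cmod (f r - g r) \<le> d"
    and f: "(\<Sum>r<R. (cmod (f r))\<^sup>2) \<le> M\<^sup>2" and g: "(\<Sum>r<R. (cmod (g r))\<^sup>2) \<le> M\<^sup>2"
  shows "(\<Sum>r<R. ((cmod (f r))\<^sup>2 - (cmod (g r))\<^sup>2)\<^sup>2) \<le> 4 * d\<^sup>2 * M\<^sup>2"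
proof -
  have "(\<Sum>r<R. ((cmod (f r))\<^sup>2 - (cmod (g r))\<^sup>2)\<^sup>2)
      \<le> (\<Sum>r<R. d\<^sup>2 * (2 * (cmod (f r))\<^sup>2 + 2 * (cmod (g r))\<^sup>2))"
  proof (rule sum_mono)
    fix r assume "r \<in> {..<R}"
    define a b where "a = cmod (f r)" and "b = cmod (g r)"
    have "\<bar>a - b\<bar> \<le> d"
      using norm_triangle_ineq3[of "f r" "g r"] d[of r] \<open>r \<in> _\<close> by (simp add: a_def b_def)
    hence "\<bar>a - b\<bar>\<^sup>2 \<le> d\<^sup>2" by (intro power_mono) auto
    hence 1: "(a - b)\<^sup>2 \<le> d\<^sup>2" by simp
    have "(a + b)\<^sup>2 \<le> 2 * a\<^sup>2 + 2 * b\<^sup>2"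
      using zero_le_power2[of "a - b"] by (simp add: power2_eq_square algebra_simps)
    hence "(a - b)\<^sup>2 * (a + b)\<^sup>2 \<le> d\<^sup>2 * (2 * a\<^sup>2 + 2 * b\<^sup>2)"
      by (intro mult_mono 1) auto
    also have "(a - b)\<^sup>2 * (a + b)\<^sup>2 = (a\<^sup>2 - b\<^sup>2)\<^sup>2"
      by (simp add: power2_eq_square algebra_simps)
    finally show "((cmod (f r))\<^sup>2 - (cmod (g r))\<^sup>2)\<^sup>2 \<le> d\<^sup>2 * (2 * (cmod (f r))\<^sup>2 + 2 * (cmod (g r))\<^sup>2)"
      by (simp add: a_def b_def)
  qed
  also have "\<dots> = d\<^sup>2 * (2 * (\<Sum>r<R. (cmod (f r))\<^sup>2) + 2 * (\<Sum>r<R. (cmod (g r))\<^sup>2))"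
    by (simp add: sum.distrib flip: sum_distrib_left)
  also have "\<dots> \<le> d\<^sup>2 * (4 * M\<^sup>2)" using f g by (intro mult_left_mono) auto
  finally show ?thesis by simp
qed

text \<open>Every point is linked to \<open>base\<close> through nets at the scales
  \<open>\<Delta> / 2 ^ j\<close>. From one level to the next the logarithm of the net size grows
  fourfold while the subgaussian scale of the increments is halved, so one threshold
  \<open>u\<close> serves all levels and the chain costs \<open>J * u\<close>.\<close>

lemma chaining_tail:
  fixes v :: "nat \<Rightarrow> 'd \<Rightarrow> complex"
  assumes base: "base \<in> D" "\<And>r. r < R \<Longrightarrow> v r base = 0"
    and diam: "\<And>x r. x \<in> D \<Longrightarrow> r < R \<Longrightarrow> cmod (v r x) \<le> \<Delta>" "\<Delta> > 0"
    and nets: "\<And>j. 1 \<le> j \<Longrightarrow> j \<le> J \<Longrightarrow> \<exists>\<pi>. \<pi> ` D \<subseteq> D \<and> finite (\<pi> ` D) \<and>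
       real (card (\<pi> ` D)) \<le> exp (A * 4 ^ j * l\<^sup>2) \<and>
       (\<forall>x\<in>D. \<forall>r<R. cmod (v r x - v r (\<pi> x)) \<le> \<Delta> / 2 ^ j)"
    and M: "\<And>x. x \<in> D \<Longrightarrow> (\<Sum>r<R. (cmod (v r x))\<^sup>2) \<le> M\<^sup>2" "M > 0"
    and l: "l > 0" and A: "A \<ge> 0" and c: "c \<ge> 0" and \<kappa>: "\<kappa> \<ge> 0" "\<kappa>\<^sup>2 / 72 \<ge> 2 * A + c"
    and J: "sqrt (real R) \<le> 2 ^ J"
  shows "real (card {\<sigma> \<in> signs R. \<exists>x\<in>D. \<bar>\<Sum>r<R. \<sigma> r * (cmod (v r x))\<^sup>2\<bar> > (real J * \<kappa> * l + 2) * \<Delta> * M})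
      \<le> real J * (2 * exp (- 4 * c * l\<^sup>2)) * 2 ^ R"
proof -
  define X where "X \<sigma> x = (\<Sum>r<R. \<sigma> r * (cmod (v r x))\<^sup>2)" for \<sigma> :: "nat \<Rightarrow> real" and x
  have "\<exists>\<pi>. \<pi> ` D \<subseteq> D \<and> finite (\<pi> ` D) \<and>
       real (card (\<pi> ` D)) \<le> exp (A * 4 ^ j * l\<^sup>2) \<and>
       (\<forall>x\<in>D. \<forall>r<R. cmod (v r x - v r (\<pi> x)) \<le> \<Delta> / 2 ^ j) \<and> (j = 0 \<longrightarrow> \<pi> = (\<lambda>_. base))" if j: "j \<le> J" for j
  \<comment> \<open>Level 0 is the one-point net at \<open>base\<close>: its scale is
    \<open>\<Delta>\<close>, the process vanishes there, and \<open>\<Delta>\<close> bounds all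
    values.\<close>
  proof (cases "j = 0")
    case True
    have "(\<lambda>_. base) ` D = {base}" using base by auto
    thus ?thesis using True base diam A by (intro exI[of _ "\<lambda>_. base"]) auto
  next
    case False
    thus ?thesis using nets[of j] j by auto
  qed
  then obtain \<pi> where \<pi>: "\<And>j. j \<le> J \<Longrightarrow> \<pi> j ` D \<subseteq> D"
    "\<And>j. j \<le> J \<Longrightarrow> finite (\<pi> j ` D)"
    "\<And>j. j \<le> J \<Longrightarrow> real (card (\<pi> j ` D)) \<le> exp (A * 4 ^ j * l\<^sup>2)"
    "\<And>j x r. j \<le> J \<Longrightarrow> x \<in> D \<Longrightarrow> r < R \<Longrightarrow> cmod (v r x - v r (\<pi> j x)) \<le> \<Delta> / 2 ^ j"
    "\<pi> 0 = (\<lambda>_. base)"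
    by (metis le0)
  define u where "u = \<kappa> * l * \<Delta> * M"
  have u: "u \<ge> 0" using \<kappa> l diam M by (simp add: u_def)
  define P where "P j = (\<lambda>x. (\<pi> (Suc j) x, \<pi> j x)) ` D" for j
  define Bad where "Bad j = (\<Union>(y, z)\<in>P j. {\<sigma> \<in> signs R. \<bar>X \<sigma> y - X \<sigma> z\<bar> > u})" for j
  have Xdiff: "X \<sigma> y - X \<sigma> z = (\<Sum>r<R. \<sigma> r * ((cmod (v r y))\<^sup>2 - (cmod (v r z))\<^sup>2))" for \<sigma> y z
    by (simp add: X_def algebra_simps sum_subtractf)
  have bad: "real (card (Bad j)) \<le> 2 * exp (- 4 * c * l\<^sup>2) * 2 ^ R" if j: "j < J" for j
  proof -
    \<comment> \<open>Consecutive approximants of a point differ in each row by at most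
      \<open>\<Delta> / 2 ^ Suc j + \<Delta> / 2 ^ j\<close>, that is, three times the finer scale;
      the squared l2 norm of the increment thus carries the constant
      \<open>4 * 3\<^sup>2 = 36\<close>.\<close>
    define V where "V = 36 * \<Delta>\<^sup>2 * M\<^sup>2 / 4 ^ Suc j"
    have fin: "finite (P j)"
      by (rule finite_subset[of _ "\<pi> (Suc j) ` D \<times> \<pi> j ` D"]) (use j in \<open>auto simp: P_def intro!: \<pi>\<close>)
    have "card (P j) \<le> card (\<pi> (Suc j) ` D \<times> \<pi> j ` D)"
      by (rule card_mono) (use j in \<open>auto simp: P_def intro!: \<pi>\<close>)
    hence "real (card (P j)) \<le> real (card (\<pi> (Suc j) ` D)) * real (card (\<pi> j ` D))"
      by (simp add: card_cartesian_product flip: of_nat_mult)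
    also have "\<dots> \<le> exp (A * 4 ^ Suc j * l\<^sup>2) * exp (A * 4 ^ Suc j * l\<^sup>2)"
    proof (intro mult_mono)
      show "real (card (\<pi> (Suc j) ` D)) \<le> exp (A * 4 ^ Suc j * l\<^sup>2)" using j by (intro \<pi>) auto
      have "real (card (\<pi> j ` D)) \<le> exp (A * 4 ^ j * l\<^sup>2)" using j by (intro \<pi>) auto
      also have "\<dots> \<le> exp (A * 4 ^ Suc j * l\<^sup>2)"
        unfolding exp_le_cancel_iff by (intro mult_right_mono mult_left_mono A power_increasing) auto
      finally show "real (card (\<pi> j ` D)) \<le> exp (A * 4 ^ Suc j * l\<^sup>2)" .
    qed auto
    also have "\<dots> = exp (2 * A * 4 ^ Suc j * l\<^sup>2)" by (simp flip: exp_add)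
    finally have cP: "real (card (P j)) \<le> exp (2 * A * 4 ^ Suc j * l\<^sup>2)" .
    have pair: "real (card {\<sigma> \<in> signs R. \<bar>X \<sigma> y - X \<sigma> z\<bar> > u}) \<le> 2 * exp (- u\<^sup>2 / (2 * V)) * 2 ^ R"
      if yz: "(y, z) \<in> P j" for y z
      unfolding Xdiff
    proof (rule rademacher_tail)
      obtain x where x: "x \<in> D" "y = \<pi> (Suc j) x" "z = \<pi> j x" using yz by (auto simp: P_def)
      have yz': "y \<in> D" "z \<in> D" using x \<pi>(1)[of j] \<pi>(1)[of "Suc j"] j by auto
      have "cmod (v r y - v r z) \<le> 3 * \<Delta> / 2 ^ Suc j" if r: "r < R" for r
      proof -
        have "cmod (v r x - v r y) \<le> \<Delta> / 2 ^ Suc j" "cmod (v r x - v r z) \<le> \<Delta> / 2 ^ j"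
          using \<pi>(4)[of "Suc j" x r] \<pi>(4)[of j x r] j x r by auto
        moreover have "cmod (v r y - v r z) \<le> cmod (v r x - v r y) + cmod (v r x - v r z)"
          by (metis dist_norm dist_triangle3)
        moreover have "\<Delta> / 2 ^ j = 2 * (\<Delta> / 2 ^ Suc j)" "3 * \<Delta> / 2 ^ Suc j = 3 * (\<Delta> / 2 ^ Suc j)" by simp_all
        ultimately show ?thesis by linarith
      qed
      from sum_square_norm_diff_le[OF this M(1)[OF yz'(1)] M(1)[OF yz'(2)]]
      have "(\<Sum>r<R. ((cmod (v r y))\<^sup>2 - (cmod (v r z))\<^sup>2)\<^sup>2) \<le> 4 * (3 * \<Delta> / 2 ^ Suc j)\<^sup>2 * M\<^sup>2" .
      also have "\<dots> = V"
      proof -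
        have "(2 ^ Suc j)\<^sup>2 = (4 ^ Suc j :: real)" by (metis power2_eq_square power_mult_distrib num_double numeral_times_numeral)
        thus ?thesis unfolding V_def power_divide power_mult_distrib by simp
      qed
      finally show "(\<Sum>r<R. ((cmod (v r y))\<^sup>2 - (cmod (v r z))\<^sup>2)\<^sup>2) \<le> V" .
      show "V > 0" using diam M by (simp add: V_def)
    qed (rule u)
    \<comment> \<open>The tail exponent and the logarithm of the number of pairs carry the same
      factor \<open>4 ^ Suc j * l\<^sup>2\<close>, with coefficients
      \<open>\<kappa>\<^sup>2 / 72\<close> and \<open>2 * A\<close>. A surplus of at least
      \<open>c\<close> remains, and \<open>4 ^ Suc j \<ge> 4\<close> gives the final
      exponent.\<close>
    have eq: "u\<^sup>2 / (2 * V) = \<kappa>\<^sup>2 / 72 * 4 ^ Suc j * l\<^sup>2"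
      using diam M by (simp add: u_def V_def power_mult_distrib field_simps)
    have "real (card (Bad j)) \<le> (\<Sum>p\<in>P j. real (card {\<sigma> \<in> signs R. \<bar>X \<sigma> (fst p) - X \<sigma> (snd p)\<bar> > u}))"
      unfolding Bad_def case_prod_beta of_nat_sum[symmetric] of_nat_le_iff by (rule card_UN_le[OF fin])
    also have "\<dots> \<le> (\<Sum>p\<in>P j. 2 * exp (- u\<^sup>2 / (2 * V)) * 2 ^ R)"
      by (intro sum_mono pair) auto
    also have "\<dots> = real (card (P j)) * (2 * exp (- u\<^sup>2 / (2 * V)) * 2 ^ R)" by simp
    also have "\<dots> \<le> exp (2 * A * 4 ^ Suc j * l\<^sup>2) * (2 * exp (- u\<^sup>2 / (2 * V)) * 2 ^ R)"
      by (rule mult_right_mono[OF cP]) simp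
    also have "\<dots> = 2 * exp (- (\<kappa>\<^sup>2 / 72 - 2 * A) * 4 ^ Suc j * l\<^sup>2) * 2 ^ R"
    proof -
      have "exp (2 * A * 4 ^ Suc j * l\<^sup>2) * exp (- u\<^sup>2 / (2 * V)) = exp (- (\<kappa>\<^sup>2 / 72 - 2 * A) * 4 ^ Suc j * l\<^sup>2)"
        unfolding exp_add[symmetric] minus_divide_left[symmetric] eq by (simp add: algebra_simps)
      thus ?thesis by (simp add: mult_ac)
    qed
    also have "\<dots> \<le> 2 * exp (- 4 * c * l\<^sup>2) * 2 ^ R"
    proof (intro mult_right_mono mult_left_mono)
      have "c * 4 \<le> (\<kappa>\<^sup>2 / 72 - 2 * A) * 4 ^ Suc j"
        by (rule mult_mono) (use \<kappa> c in auto)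
      hence "c * 4 * l\<^sup>2 \<le> (\<kappa>\<^sup>2 / 72 - 2 * A) * 4 ^ Suc j * l\<^sup>2" by (rule mult_right_mono) simp
      thus "exp (- (\<kappa>\<^sup>2 / 72 - 2 * A) * 4 ^ Suc j * l\<^sup>2) \<le> exp (- 4 * c * l\<^sup>2)"
        unfolding exp_le_cancel_iff by linarith
    qed auto
    finally show ?thesis .
  qed
  have sub: "{\<sigma> \<in> signs R. \<exists>x\<in>D. \<bar>X \<sigma> x\<bar> > (real J * \<kappa> * l + 2) * \<Delta> * M} \<subseteq> (\<Union>j<J. Bad j)"
  proof (rule subsetI, rule ccontr)
    fix \<sigma> assume "\<sigma> \<in> {\<sigma> \<in> signs R. \<exists>x\<in>D. \<bar>X \<sigma> x\<bar> > (real J * \<kappa> * l + 2) * \<Delta> * M}"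
    then obtain x where s: "\<sigma> \<in> signs R" and x: "x \<in> D" "\<bar>X \<sigma> x\<bar> > (real J * \<kappa> * l + 2) * \<Delta> * M" by auto
    assume "\<sigma> \<notin> (\<Union>j<J. Bad j)"
    hence step: "\<bar>X \<sigma> (\<pi> (Suc j) x) - X \<sigma> (\<pi> j x)\<bar> \<le> u" if "j < J" for j
      using that s x by (fastforce simp: Bad_def P_def not_less)
    have "X \<sigma> (\<pi> J x) - X \<sigma> (\<pi> 0 x) = (\<Sum>j<J. X \<sigma> (\<pi> (Suc j) x) - X \<sigma> (\<pi> j x))"
      by (rule sum_lessThan_telescope[symmetric])
    hence "\<bar>X \<sigma> (\<pi> J x) - X \<sigma> (\<pi> 0 x)\<bar> \<le> (\<Sum>j<J. \<bar>X \<sigma> (\<pi> (Suc j) x) - X \<sigma> (\<pi> j x)\<bar>)" by simp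
    also have "\<dots> \<le> (\<Sum>j<J. u)" by (intro sum_mono step) auto
    finally have 1: "\<bar>X \<sigma> (\<pi> J x) - X \<sigma> (\<pi> 0 x)\<bar> \<le> real J * u" by simp
    have 2: "X \<sigma> (\<pi> 0 x) = 0" by (simp add: X_def \<pi>(5) base)
    \<comment> \<open>Beyond level \<open>J\<close> no probability is involved: Cauchy-Schwarz over
      the rows costs a factor \<open>sqrt R \<le> 2 ^ J\<close>, which the scale
      \<open>\<Delta> / 2 ^ J\<close> cancels.\<close>
    define a where "a r = \<bar>(cmod (v r x))\<^sup>2 - (cmod (v r (\<pi> J x)))\<^sup>2\<bar>" for r
    have "(\<Sum>r<R. a r)\<^sup>2 \<le> (\<Sum>r<R. (a r)\<^sup>2) * real R"
      using sum_squared_le_sum_of_squares[of a "{..<R}"] by simp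
    also have "\<dots> \<le> (4 * (\<Delta> / 2 ^ J)\<^sup>2 * M\<^sup>2) * (2 ^ J)\<^sup>2"
    proof (intro mult_mono)
      have "\<pi> J x \<in> D" using \<pi>(1)[of J] x by auto
      from sum_square_norm_diff_le[OF \<pi>(4)[of J x] M(1)[OF x(1)] M(1)[OF this]] x
      show "(\<Sum>r<R. (a r)\<^sup>2) \<le> 4 * (\<Delta> / 2 ^ J)\<^sup>2 * M\<^sup>2" by (simp add: a_def)
      have "(sqrt (real R))\<^sup>2 \<le> (2 ^ J)\<^sup>2" using J by (intro power_mono) auto
      thus "real R \<le> (2 ^ J)\<^sup>2" by simp
    qed auto
    also have "\<dots> = (2 * \<Delta> * M)\<^sup>2" by (simp add: power_mult_distrib power_divide)
    finally have 3: "(\<Sum>r<R. a r) \<le> 2 * \<Delta> * M"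
      by (rule power2_le_imp_le) (use diam M in auto)
    have "\<bar>X \<sigma> x - X \<sigma> (\<pi> J x)\<bar> \<le> (\<Sum>r<R. \<bar>\<sigma> r * ((cmod (v r x))\<^sup>2 - (cmod (v r (\<pi> J x)))\<^sup>2)\<bar>)"
      unfolding Xdiff by (rule sum_abs)
    also have "\<dots> \<le> (\<Sum>r<R. a r)"
      using signs_cases[OF s] by (intro sum_mono) (metis a_def abs_minus_cancel mult_1 mult_minus1 order_refl)
    finally have "\<bar>X \<sigma> x\<bar> \<le> real J * u + 2 * \<Delta> * M" using 1 2 3 by linarith
    also have "\<dots> = (real J * \<kappa> * l + 2) * \<Delta> * M" by (simp add: u_def algebra_simps)
    finally show False using x by simp
  qed
  have fB: "finite (\<Union>j<J. Bad j)" 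
    by (rule finite_subset[of _ "signs R"]) (auto simp: Bad_def)
  have "real (card {\<sigma> \<in> signs R. \<exists>x\<in>D. \<bar>X \<sigma> x\<bar> > (real J * \<kappa> * l + 2) * \<Delta> * M}) \<le> real (card (\<Union>j<J. Bad j))"
    using card_mono[OF fB sub] by simp
  also have "\<dots> \<le> (\<Sum>j<J. real (card (Bad j)))"
    unfolding of_nat_sum[symmetric] of_nat_le_iff by (rule card_UN_le) simp
  also have "\<dots> \<le> (\<Sum>j<J. 2 * exp (- 4 * c * l\<^sup>2) * 2 ^ R)" by (intro sum_mono bad) auto
  finally show ?thesis by (simp add: X_def mult_ac)
qed

section \<open>Chaining over the empirical nets\<close>

lemma exp_neg_square_ln_le:
  assumes W: "W \<ge> (8::nat)"
  shows "2 \<le> ln (real W)" and "exp (- 8 * (ln (real W))\<^sup>2) \<le> 1 / real W ^ 7"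
proof -
  have "exp 2 = (exp 1 :: real) ^ 2" by (simp flip: exp_of_nat_mult)
  also have "\<dots> \<le> (272 / 100 :: real) ^ 2" by (intro power_mono less_imp_le[OF e_less_272]) auto
  also have "\<dots> \<le> real W" using W by (simp add: power2_eq_square)
  finally show l: "2 \<le> ln (real W)" using W by (subst ln_ge_iff) auto
  have "7 * ln (real W) \<le> 8 * (ln (real W) * ln (real W))" using l by (intro mult_mono) auto
  hence "exp (- 8 * (ln (real W))\<^sup>2) \<le> exp (- (7 * ln (real W)))" by (simp add: power2_eq_square)
  also have "\<dots> = 1 / real W ^ 7"
    using W exp_of_nat_mult[of 7 "ln (real W)"] by (simp add: exp_minus divide_inverse)
  finally show "exp (- 8 * (ln (real W))\<^sup>2) \<le> 1 / real W ^ 7" .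
qed

text \<open>With diameter \<open>s * B\<close>, about \<open>4 ^ j * l\<close> samples give relative
  accuracy \<open>2 ^ (- j)\<close>, and each sample multiplies the number of codes by
  \<open>4 * W \<le> W\<^sup>2\<close>. The logarithm of the net size is thus of order
  \<open>4 ^ j * l\<^sup>2\<close>, as \<open>chaining_tail\<close> demands.\<close>

lemma rudelson_vershynin_tail:
  fixes \<phi> :: "nat \<Rightarrow> nat \<Rightarrow> complex" and D :: "(nat \<Rightarrow> complex) set" and W R :: nat
  defines "L \<equiv> \<lambda>r x. \<Sum>i<W. \<phi> r i * x i"
  assumes D: "(\<lambda>_. 0) \<in> D" "\<And>x. x \<in> D \<Longrightarrow> (\<Sum>i<W. cmod (x i)) \<le> s" and s: "s > 0"
    and W: "W \<ge> 8" "R > 0" "R \<le> W"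
    and B: "\<And>r i. r < R \<Longrightarrow> i < W \<Longrightarrow> cmod (\<phi> r i) \<le> B" "B > 0"
    and M: "\<And>x. x \<in> D \<Longrightarrow> (\<Sum>r<R. (cmod (L r x))\<^sup>2) \<le> M\<^sup>2" "M > 0"
  shows "real (card {\<sigma> \<in> signs R. \<exists>x\<in>D. \<bar>\<Sum>r<R. \<sigma> r * (cmod (L r x))\<^sup>2\<bar> > 1802 * (s * B) * (ln (real W))\<^sup>2 * M})
      \<le> 2 ^ R / real W ^ 5"
proof -
  define l where "l = ln (real W)"
  have l: "l \<ge> 2" using exp_neg_square_ln_le(1)[OF W(1)] by (simp add: l_def)
  have nat_ceiling_le: "real (nat \<lceil>y\<rceil>) \<le> y + 1" if "y \<ge> 0" for y :: real
    using of_int_ceiling_le_add_one[of y] that by (simp add: of_nat_nat)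
  have W0: "W > 0" using W by simp
  have expl: "exp l = real W" using W by (simp add: l_def)
  define J where "J = nat \<lceil>log 2 (real W)\<rceil>"
  have "log 2 (real W) \<le> real J" unfolding J_def by (rule real_nat_ceiling_ge)
  hence "2 powr (log 2 (real W)) \<le> 2 powr real J" by simp
  hence WJ: "real W \<le> 2 ^ J" using W by (simp add: powr_realpow)
  have "log 2 (real W) \<le> 2 * l"
  proof -
    have "(1 / 2) * l \<le> ln 2 * l" using l ln2_ge_two_thirds by (intro mult_right_mono) auto
    thus ?thesis by (simp add: log_def l_def field_simps)
  qed
  moreover have "real J \<le> log 2 (real W) + 1"
    unfolding J_def using W by (intro nat_ceiling_le) auto
  ultimately have J3: "real J \<le> 3 * l" using l by linarith
  have "real (card {\<sigma> \<in> signs R. \<exists>x\<in>D. \<bar>\<Sum>r<R. \<sigma> r * (cmod (L r x))\<^sup>2\<bar> > (real J * 600 * l + 2) * (s * B) * M})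
      \<le> real J * (2 * exp (- 4 * 2 * l\<^sup>2)) * 2 ^ R"
  \<comment> \<open>The choice \<open>\<kappa> = 600\<close> is admissible because
    \<open>600\<^sup>2 / 72 = 5000\<close> exceeds \<open>2 * 2050 + 2\<close>; \<open>c = 2\<close>
    produces the failure term \<open>exp (- 8 * l\<^sup>2)\<close>, at most
    \<open>1 / W ^ 7\<close>.\<close>
  proof (rule chaining_tail[where base = "\<lambda>_. 0" and A = 2050])
    show "L r (\<lambda>_. 0) = 0" for r by (simp add: L_def)
    show "cmod (L r x) \<le> s * B" if "x \<in> D" "r < R" for x r
    proof -
      have "cmod (L r x) \<le> (\<Sum>i<W. cmod (\<phi> r i * x i))" unfolding L_def by (rule norm_sum)
      also have "\<dots> \<le> (\<Sum>i<W. B * cmod (x i))"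
        unfolding norm_mult using that by (intro sum_mono mult_right_mono B) auto
      also have "\<dots> = (\<Sum>i<W. cmod (x i)) * B" by (simp add: sum_distrib_left mult.commute)
      also have "\<dots> \<le> s * B" using D(2)[OF that(1)] B by (intro mult_right_mono) auto
      finally show ?thesis .
    qed
    fix j :: nat assume "1 \<le> j" "j \<le> J"
    \<comment> \<open>The factor 1024 is twice the 512 of \<open>l1_net\<close>, so the exponent
      there is at least \<open>2 * l\<close>, and \<open>exp (2 * l) = W\<^sup>2\<close> exceeds
      \<open>4 * R\<close>. Rounding up gives 1025, and \<open>W ^ (2 * k)\<close> codes give
      \<open>2050 = 2 * 1025\<close>.\<close>
    define k where "k = nat \<lceil>1024 * 4 ^ j * l\<rceil>"
    have kl: "1024 * 4 ^ j * l \<le> real k" unfolding k_def by (rule real_nat_ceiling_ge)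
    have p4: "(1::real) \<le> 4 ^ j" by simp
    have p4l: "4 ^ j * l \<ge> 1" using mult_mono[of 1 "4 ^ j" 1 l] p4 l by simp
    have ku: "real k \<le> 1025 * 4 ^ j * l"
    proof -
      have "real k \<le> 1024 * 4 ^ j * l + 1" unfolding k_def using l by (intro nat_ceiling_le) auto
      thus ?thesis using p4l by linarith
    qed
    have kpos: "k > 0" proof -
      have "real k > 0" using kl p4l by linarith
      thus ?thesis by simp
    qed
    have "\<exists>\<pi>. \<pi> ` D \<subseteq> D \<and> finite (\<pi> ` D) \<and> card (\<pi> ` D) \<le> (4 * W) ^ k \<and>
     (\<forall>x\<in>D. \<forall>r<R. cmod ((\<Sum>i<W. \<phi> r i * x i) - (\<Sum>i<W. \<phi> r i * \<pi> x i)) \<le> s * B / 2 ^ j)"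
    proof (rule l1_net)
      have "real k * (s * B / 2 ^ j)\<^sup>2 / (512 * s\<^sup>2 * B\<^sup>2) = real k / (512 * (2 ^ j)\<^sup>2)"
        using s B by (simp add: power_mult_distrib power_divide)
      also have "(2 ^ j)\<^sup>2 = (4 ^ j :: real)"
        by (metis power2_eq_square power_mult_distrib num_double numeral_times_numeral)
      finally have "real k * (s * B / 2 ^ j)\<^sup>2 / (512 * s\<^sup>2 * B\<^sup>2) = real k / (512 * 4 ^ j)" .
      moreover have "2 * l \<le> real k / (512 * 4 ^ j)" using kl by (simp add: field_simps)
      ultimately have e: "exp (2 * l) \<le> exp (real k * (s * B / 2 ^ j)\<^sup>2 / (512 * s\<^sup>2 * B\<^sup>2))" by simp
      have "4 * real R < 8 * real W" using W by simp
      also have "\<dots> \<le> real W * real W" using W by (intro mult_right_mono) auto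
      also have "\<dots> = exp (2 * l)" unfolding mult_2 exp_add expl ..
      finally show "4 * real R < exp (real k * (s * B / 2 ^ j)\<^sup>2 / (512 * s\<^sup>2 * B\<^sup>2))" using e by linarith
    qed (use D s W0 B kpos in auto)
    then obtain \<pi> where \<pi>: "\<pi> ` D \<subseteq> D" "finite (\<pi> ` D)" "card (\<pi> ` D) \<le> (4 * W) ^ k"
      "\<And>x r. x \<in> D \<Longrightarrow> r < R \<Longrightarrow> cmod (L r x - L r (\<pi> x)) \<le> s * B / 2 ^ j"
      unfolding L_def by blast
    have "real (card (\<pi> ` D)) \<le> real (4 * W) ^ k" using \<pi>(3) by (metis of_nat_le_iff of_nat_power)
    also have "\<dots> \<le> (real W * real W) ^ k" using W by (intro power_mono) auto
    also have "\<dots> = exp (real k * (2 * l))" 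
      unfolding exp_of_nat_mult mult_2 exp_add expl ..
    also have "\<dots> \<le> exp (2050 * 4 ^ j * l\<^sup>2)"
      using mult_right_mono[OF ku, of "2 * l"] l by (simp add: power2_eq_square)
    finally show "\<exists>\<pi>. \<pi> ` D \<subseteq> D \<and> finite (\<pi> ` D) \<and> real (card (\<pi> ` D)) \<le> exp (2050 * 4 ^ j * l\<^sup>2) \<and>
       (\<forall>x\<in>D. \<forall>r<R. cmod (L r x - L r (\<pi> x)) \<le> s * B / 2 ^ j)"
      using \<pi> by blast
  next
    have "sqrt (real R) \<le> real R" using W by (intro real_le_lsqrt) (auto simp: power2_eq_square)
    thus "sqrt (real R) \<le> 2 ^ J" using W WJ by linarith
  qed (use D M l s B in \<open>auto simp: power2_eq_square\<close>)
  also have "real J * (2 * exp (- 4 * 2 * l\<^sup>2)) * 2 ^ R \<le> 2 ^ R / real W ^ 5"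
  proof -
    have "l \<le> real W" using W ln_le_minus_one[of "real W"] by (simp add: l_def)
    moreover have "8 * real W \<le> real W * real W" using W by (intro mult_right_mono) auto
    ultimately have "real J * 2 \<le> real W * real W" using J3 by linarith
    hence "real J * 2 * exp (- 8 * l\<^sup>2) \<le> (real W * real W) * (1 / real W ^ 7)"
      using exp_neg_square_ln_le(2)[OF W(1)] unfolding l_def by (rule mult_mono) auto
    also have "\<dots> = 1 / real W ^ 5" using W by (simp add: eval_nat_numeral)
    finally have "real J * 2 * exp (- 8 * l\<^sup>2) * 2 ^ R \<le> 1 / real W ^ 5 * 2 ^ R"
      by (rule mult_right_mono) simp
    thus ?thesis by (simp add: mult.assoc)
  qed
  finally have main: "real (card {\<sigma> \<in> signs R. \<exists>x\<in>D. \<bar>\<Sum>r<R. \<sigma> r * (cmod (L r x))\<^sup>2\<bar> > (real J * 600 * l + 2) * (s * B) * M})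
      \<le> 2 ^ R / real W ^ 5" .
  \<comment> \<open>Since \<open>J \<le> 3 * l\<close> and \<open>l \<ge> 1\<close>, the constant is
    \<open>3 * 600 + 2\<close>.\<close>
  have "real J * 600 * l + 2 \<le> 1802 * l\<^sup>2"
  proof -
    have "real J * (600 * l) \<le> 3 * l * (600 * l)" using J3 l by (intro mult_right_mono) auto
    moreover have "1 \<le> l * l" using mult_mono[of 1 l 1 l] l by simp
    ultimately show ?thesis unfolding power2_eq_square by linarith
  qed
  hence "(real J * 600 * l + 2) * (s * B * M) \<le> (1802 * l\<^sup>2) * (s * B * M)"
    using s B M by (intro mult_right_mono) auto
  hence le: "(real J * 600 * l + 2) * (s * B) * M \<le> 1802 * (s * B) * l\<^sup>2 * M" by (simp add: mult_ac)
  have "card {\<sigma> \<in> signs R. \<exists>x\<in>D. \<bar>\<Sum>r<R. \<sigma> r * (cmod (L r x))\<^sup>2\<bar> > 1802 * (s * B) * l\<^sup>2 * M}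
    \<le> card {\<sigma> \<in> signs R. \<exists>x\<in>D. \<bar>\<Sum>r<R. \<sigma> r * (cmod (L r x))\<^sup>2\<bar> > (real J * 600 * l + 2) * (s * B) * M}"
    using le by (intro card_mono) (auto intro: le_less_trans)
  thus ?thesis using main unfolding l_def by linarith
qed

section \<open>Symmetrization over blocks\<close>

lemma sum_signs_mult:
  assumes "n < W" "m < W"
  shows "(\<Sum>\<epsilon>\<in>signs W. \<epsilon> n * \<epsilon> m) = (if n = m then 2 ^ W else 0)"
proof (cases "n = m")
  case True
  have "(\<Sum>\<epsilon>\<in>signs W. \<epsilon> n * \<epsilon> m) = (\<Sum>\<epsilon>\<in>signs W. 1)"
  proof (intro sum.cong refl)
    fix \<epsilon> assume "\<epsilon> \<in> signs W"
    from signs_cases[OF this, of n] show "\<epsilon> n * \<epsilon> m = 1" using True by auto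
  qed
  thus ?thesis using True by simp
next
  case False
  \<comment> \<open>Flipping the sign at \<open>n\<close> is an involution of
    \<open>signs W\<close>, as \<open>n < W\<close>, and negates the product, so the sum equals its
    own negative.\<close>
  let ?f = "\<lambda>\<epsilon>::nat \<Rightarrow> real. \<epsilon>(n := - \<epsilon> n)"
  have "(\<Sum>\<epsilon>\<in>signs W. \<epsilon> n * \<epsilon> m) = (\<Sum>\<epsilon>\<in>signs W. ?f \<epsilon> n * ?f \<epsilon> m)"
    by (rule sum.reindex_bij_witness[of _ ?f ?f]) (use assms in \<open>auto simp: signs_iff\<close>)
  also have "\<dots> = - (\<Sum>\<epsilon>\<in>signs W. \<epsilon> n * \<epsilon> m)" using False by (simp add: sum_negf)
  finally show ?thesis using False by simp
qed

lemma sum_signs_norm_square: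
  fixes f :: "nat \<Rightarrow> complex"
  assumes B: "B \<subseteq> {..<W}"
  shows "(\<Sum>\<epsilon>\<in>signs W. (cmod (\<Sum>n\<in>B. of_real (\<epsilon> n) * f n))\<^sup>2) = 2 ^ W * (\<Sum>n\<in>B. (cmod (f n))\<^sup>2)"
proof -
  have fin: "finite B" using B finite_subset by blast
  have "complex_of_real (\<Sum>\<epsilon>\<in>signs W. (cmod (\<Sum>n\<in>B. of_real (\<epsilon> n) * f n))\<^sup>2)
     = (\<Sum>\<epsilon>\<in>signs W. \<Sum>n\<in>B. \<Sum>m\<in>B. of_real (\<epsilon> n * \<epsilon> m) * (f n * cnj (f m)))"
    unfolding of_real_sum complex_norm_square by (simp add: sum_product mult_ac)
  also have "\<dots> = (\<Sum>n\<in>B. \<Sum>m\<in>B. of_real (\<Sum>\<epsilon>\<in>signs W. \<epsilon> n * \<epsilon> m) * (f n * cnj (f m)))"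
    by (subst sum.swap, intro sum.cong refl, subst sum.swap) (simp add: sum_distrib_right)
  also have "\<dots> = (\<Sum>n\<in>B. \<Sum>m\<in>B. if n = m then 2 ^ W * (f n * cnj (f n)) else 0)"
    using B by (intro sum.cong refl) (auto simp: sum_signs_mult subset_iff simp del: of_real_sum)
  also have "\<dots> = complex_of_real (2 ^ W * (\<Sum>n\<in>B. (cmod (f n))\<^sup>2))"
    unfolding of_real_mult of_real_sum complex_norm_square using fin by (simp add: sum_distrib_left)
  finally show ?thesis unfolding of_real_eq_iff .
qed

text \<open>Exchanging the signs of two independent copies on the blocks where \<open>\<sigma>\<close> is \<open>-1\<close> preserves
  their joint law and multiplies the block terms of the difference by \<open>\<sigma>\<close>.\<close>

lemma block_symmetrization:
  fixes Z :: "(nat \<Rightarrow> real) \<Rightarrow> nat \<Rightarrow> 'd \<Rightarrow> real" and N :: "'d \<Rightarrow> real" and R b :: nat and D :: "'d set"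
  defines "W \<equiv> R * b" and "T \<equiv> \<lambda>\<epsilon> x. \<Sum>r<R. Z \<epsilon> r x"
  defines "\<Psi> \<equiv> \<lambda>\<epsilon>. SUP x\<in>D. \<bar>T \<epsilon> x - N x\<bar>" and "S \<equiv> \<lambda>\<sigma> \<epsilon>. SUP x\<in>D. \<bar>\<Sum>r<R. \<sigma> r * Z \<epsilon> r x\<bar>"
  assumes local: "\<And>\<epsilon> \<epsilon>' r x. r < R \<Longrightarrow> (\<And>n. n div b = r \<Longrightarrow> \<epsilon> n = \<epsilon>' n) \<Longrightarrow> Z \<epsilon> r x = Z \<epsilon>' r x"
    and b: "b > 0" and D: "D \<noteq> {}"
    and mean: "\<And>x. x \<in> D \<Longrightarrow> (\<Sum>\<epsilon>\<in>signs W. T \<epsilon> x) = 2 ^ W * N x"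
    and Z: "\<And>\<epsilon> r x. \<epsilon> \<in> signs W \<Longrightarrow> r < R \<Longrightarrow> x \<in> D \<Longrightarrow> 0 \<le> Z \<epsilon> r x"
    and bound: "\<And>\<epsilon> x. \<epsilon> \<in> signs W \<Longrightarrow> x \<in> D \<Longrightarrow> T \<epsilon> x \<le> C"
    and t: "t \<ge> 0" and \<sigma>: "\<sigma> \<in> signs R"
  shows "(\<Sum>\<epsilon>\<in>signs W. max 0 (\<Psi> \<epsilon> - 2 * t)) \<le> 2 * (\<Sum>\<epsilon>\<in>signs W. max 0 (S \<sigma> \<epsilon> - t))"
proof -
  define X where "X \<epsilon> x = (\<Sum>r<R. \<sigma> r * Z \<epsilon> r x)" for \<epsilon> x
  define G where "G \<epsilon> \<epsilon>' = (SUP x\<in>D. \<bar>T \<epsilon> x - T \<epsilon>' x\<bar>)" for \<epsilon> \<epsilon>'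
  define sw where "sw = (\<lambda>(\<epsilon>, \<epsilon>'). (\<lambda>n. if \<sigma> (n div b) = 1 then \<epsilon> n else \<epsilon>' n :: real,
                                     \<lambda>n. if \<sigma> (n div b) = 1 then \<epsilon>' n else \<epsilon> n :: real))"
  have T0: "0 \<le> T \<epsilon> x" if "\<epsilon> \<in> signs W" "x \<in> D" for \<epsilon> x
    unfolding T_def by (intro sum_nonneg Z that) auto
  have bddG: "bdd_above ((\<lambda>x. \<bar>T \<epsilon> x - T \<epsilon>' x\<bar>) ` D)" if "\<epsilon> \<in> signs W" "\<epsilon>' \<in> signs W" for \<epsilon> \<epsilon>'
    by (rule bdd_aboveI2[of _ _ C]) (use T0 bound that in \<open>force simp: abs_le_iff\<close>)
  have bddS: "bdd_above ((\<lambda>x. \<bar>X \<epsilon> x\<bar>) ` D)" if e: "\<epsilon> \<in> signs W" for \<epsilon>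
  proof (rule bdd_aboveI2)
    fix x assume x: "x \<in> D"
    have "\<bar>X \<epsilon> x\<bar> \<le> (\<Sum>r<R. \<bar>\<sigma> r * Z \<epsilon> r x\<bar>)" unfolding X_def by (rule sum_abs)
    also have "\<dots> \<le> T \<epsilon> x" unfolding T_def
      using signs_cases[OF \<sigma>] Z[OF e _ x] 
      by (intro sum_mono) (metis abs_minus_cancel abs_of_nonneg lessThan_iff mult_1 mult_minus1 order_refl)
    finally show "\<bar>X \<epsilon> x\<bar> \<le> C" using bound[OF e x] by simp
  qed
  have X_le: "\<bar>X \<epsilon> x\<bar> \<le> S \<sigma> \<epsilon>" if "\<epsilon> \<in> signs W" "x \<in> D" for \<epsilon> x
    using cSUP_upper[OF that(2) bddS[OF that(1)]] by (simp add: S_def X_def)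
  \<comment> \<open>A form of Jensen's inequality: \<open>N x\<close> is the mean of
    \<open>T\<close> over an independent copy. The truncation is carried along by
    \<open>y \<le> max 0 (y - 2 * t) + 2 * t\<close>.\<close>
  have jensen: "max 0 (\<Psi> \<epsilon> - 2 * t) \<le> (\<Sum>\<epsilon>'\<in>signs W. max 0 (G \<epsilon> \<epsilon>' - 2 * t)) / 2 ^ W" if e: "\<epsilon> \<in> signs W" for \<epsilon>
  proof -
    have "\<Psi> \<epsilon> \<le> (\<Sum>\<epsilon>'\<in>signs W. max 0 (G \<epsilon> \<epsilon>' - 2 * t)) / 2 ^ W + 2 * t"
      unfolding \<Psi>_def
    proof (rule cSUP_least[OF D])
      fix x assume x: "x \<in> D"
      have "2 ^ W * (T \<epsilon> x - N x) = (\<Sum>\<epsilon>'\<in>signs W. T \<epsilon> x - T \<epsilon>' x)"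
        by (simp add: sum_subtractf mean[OF x] algebra_simps)
      hence "2 ^ W * \<bar>T \<epsilon> x - N x\<bar> = \<bar>\<Sum>\<epsilon>'\<in>signs W. T \<epsilon> x - T \<epsilon>' x\<bar>"
        by (metis abs_mult abs_numeral power_abs)
      also have "\<dots> \<le> (\<Sum>\<epsilon>'\<in>signs W. \<bar>T \<epsilon> x - T \<epsilon>' x\<bar>)" by (rule sum_abs)
      also have "\<dots> \<le> (\<Sum>\<epsilon>'\<in>signs W. max 0 (G \<epsilon> \<epsilon>' - 2 * t) + 2 * t)"
      proof (rule sum_mono)
        fix \<epsilon>' assume "\<epsilon>' \<in> signs W"
        from cSUP_upper[OF x bddG[OF e this]]
        show "\<bar>T \<epsilon> x - T \<epsilon>' x\<bar> \<le> max 0 (G \<epsilon> \<epsilon>' - 2 * t) + 2 * t" unfolding G_def by simp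
      qed
      also have "\<dots> = (\<Sum>\<epsilon>'\<in>signs W. max 0 (G \<epsilon> \<epsilon>' - 2 * t)) + 2 ^ W * (2 * t)"
        by (simp add: sum.distrib)
      finally show "\<bar>T \<epsilon> x - N x\<bar> \<le> (\<Sum>\<epsilon>'\<in>signs W. max 0 (G \<epsilon> \<epsilon>' - 2 * t)) / 2 ^ W + 2 * t"
        by (simp add: field_simps)
    qed
    moreover have "0 \<le> (\<Sum>\<epsilon>'\<in>signs W. max 0 (G \<epsilon> \<epsilon>' - 2 * t)) / 2 ^ W"
      by (intro divide_nonneg_nonneg sum_nonneg) auto
    ultimately show ?thesis by simp
  qed
  have sw_mem: "sw p \<in> signs W \<times> signs W" if "p \<in> signs W \<times> signs W" for p
    using that by (auto simp: sw_def signs_iff)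
  have sw_sw: "sw (sw p) = p" for p by (auto simp: sw_def split: prod.splits)
  have sw_le: "G (fst (sw p)) (snd (sw p)) \<le> S \<sigma> (fst p) + S \<sigma> (snd p)" if p: "p \<in> signs W \<times> signs W" for p
  proof -
    obtain \<epsilon> \<epsilon>' where e: "p = (\<epsilon>, \<epsilon>')" "\<epsilon> \<in> signs W" "\<epsilon>' \<in> signs W" using p by auto
    show ?thesis unfolding G_def
    proof (rule cSUP_least[OF D])
      fix x assume x: "x \<in> D"
      have "Z (fst (sw p)) r x - Z (snd (sw p)) r x = \<sigma> r * (Z \<epsilon> r x - Z \<epsilon>' r x)" if r: "r < R" for r
      proof (cases "\<sigma> r = 1")
        case True
        hence "Z (fst (sw p)) r x = Z \<epsilon> r x" "Z (snd (sw p)) r x = Z \<epsilon>' r x"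
          by (auto intro!: local r simp: sw_def e)
        thus ?thesis using True by simp
      next
        case False
        hence "Z (fst (sw p)) r x = Z \<epsilon>' r x" "Z (snd (sw p)) r x = Z \<epsilon> r x"
          by (auto intro!: local r simp: sw_def e)
        thus ?thesis using False signs_cases[OF \<sigma>, of r] by simp
      qed
      hence "T (fst (sw p)) x - T (snd (sw p)) x = X \<epsilon> x - X \<epsilon>' x"
        unfolding T_def X_def sum_subtractf[symmetric] by (simp add: right_diff_distrib)
      thus "\<bar>T (fst (sw p)) x - T (snd (sw p)) x\<bar> \<le> S \<sigma> (fst p) + S \<sigma> (snd p)"
        using X_le[OF e(2) x] X_le[OF e(3) x] by (simp add: e(1))
    qed
  qed
  have "(\<Sum>\<epsilon>\<in>signs W. max 0 (\<Psi> \<epsilon> - 2 * t))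
      \<le> (\<Sum>\<epsilon>\<in>signs W. (\<Sum>\<epsilon>'\<in>signs W. max 0 (G \<epsilon> \<epsilon>' - 2 * t)) / 2 ^ W)"
    by (intro sum_mono jensen)
  also have "\<dots> = (\<Sum>p\<in>signs W \<times> signs W. max 0 (G (fst p) (snd p) - 2 * t)) / 2 ^ W"
    by (simp add: sum.cartesian_product sum_divide_distrib[symmetric] case_prod_beta)
  also have "(\<Sum>p\<in>signs W \<times> signs W. max 0 (G (fst p) (snd p) - 2 * t))
      = (\<Sum>p\<in>signs W \<times> signs W. max 0 (G (fst (sw p)) (snd (sw p)) - 2 * t))"
    by (rule sum.reindex_bij_witness[of _ sw sw]) (use sw_mem sw_sw in auto)
  \<comment> \<open>The threshold \<open>2 * t\<close> is split between the two copies: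
    \<open>max 0 (a + b - 2 * t) \<le> max 0 (a - t) + max 0 (b - t)\<close>.\<close>
  also have "\<dots> \<le> (\<Sum>p\<in>signs W \<times> signs W. max 0 (S \<sigma> (fst p) - t) + max 0 (S \<sigma> (snd p) - t))"
    using sw_le by (intro sum_mono) fastforce
  also have "\<dots> = (\<Sum>\<epsilon>\<in>signs W. \<Sum>\<epsilon>'\<in>signs W. max 0 (S \<sigma> \<epsilon> - t) + max 0 (S \<sigma> \<epsilon>' - t))"
    by (simp add: sum.cartesian_product case_prod_beta)
  also have "\<dots> = 2 ^ W * (2 * (\<Sum>\<epsilon>\<in>signs W. max 0 (S \<sigma> \<epsilon> - t)))"
    by (simp add: sum.distrib sum_distrib_left[symmetric])
  finally show ?thesis by (simp add: divide_right_mono)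
qed

section \<open>Concentration on the l1-l2 ball\<close>

text \<open>For the Fourier matrix these block sums are the entries of the demodulator matrix. Their
  real and imaginary parts are Rademacher sums with \<open>b\<close> coefficients of square at most
  \<open>1 / W\<close>, hence variance proxy \<open>b / W = 1 / R\<close>; a union bound runs over
  all \<open>2 * R * W\<close> parts.\<close>

lemma signed_block_sum_tail:
  fixes F :: "nat \<Rightarrow> nat \<Rightarrow> complex" and R b :: nat
  defines "W \<equiv> R * b"
  assumes W: "W > 0"
    and F: "\<And>n i. n < W \<Longrightarrow> i < W \<Longrightarrow> cmod (F n i) \<le> 1 / sqrt (real W)"
  shows "real (card {\<epsilon> \<in> signs W. \<exists>r<R. \<exists>i<W.
      cmod (\<Sum>n\<in>{r * b..<r * b + b}. of_real (\<epsilon> n) * F n i) > 8 * sqrt (ln (real W) / real R)})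
    \<le> 4 / real W ^ 6 * 2 ^ W"
proof -
  \<comment> \<open>Here \<open>u\<^sup>2 * R / 2 = 8 * ln W\<close>, so a single part fails with
    probability at most \<open>2 / W ^ 8\<close>. A modulus above \<open>2 * u\<close> forces one of
    the two parts above \<open>u\<close>.\<close>
  define u where "u = 4 * sqrt (ln (real W) / real R)"
  have Rb: "R > 0" "b > 0" using W by (auto simp: W_def)
  have RW: "R \<le> W" using Rb by (simp add: W_def)
  have lnW: "ln (real W) \<ge> 0" using W by simp
  have u: "u \<ge> 0" "u\<^sup>2 = 16 * (ln (real W) / real R)"
    using lnW Rb by (auto simp: u_def power_mult_distrib)
  define g where "g = (\<lambda>(r, i, p) n. if n \<in> {r * b..<r * b + b} then (if p then Re (F n i) else Im (F n i)) else 0)"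
  define E where "E q = {\<epsilon> \<in> signs W. \<bar>\<Sum>n<W. \<epsilon> n * g q n\<bar> > u}" for q
  define I :: "(nat \<times> nat \<times> bool) set" where "I = {..<R} \<times> {..<W} \<times> UNIV"
  have blk: "{r * b..<r * b + b} \<subseteq> {..<W}" if "r < R" for r
  proof -
    have "Suc r * b \<le> R * b" using that by (intro mult_right_mono) auto
    thus ?thesis by (auto simp: W_def)
  qed
  have tail: "real (card (E q)) \<le> 2 / real W ^ 8 * 2 ^ W" if q: "q \<in> I" for q
  proof -
    obtain r i p where q': "q = (r, i, p)" "r < R" "i < W" using q by (auto simp: I_def)
    have "(\<Sum>n<W. (g q n)\<^sup>2) = (\<Sum>n\<in>{r * b..<r * b + b}. (if p then Re (F n i) else Im (F n i))\<^sup>2)"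
      by (rule sum.mono_neutral_cong_right) (use blk[OF q'(2)] in \<open>auto simp: g_def q'\<close>)
    also have "\<dots> \<le> (\<Sum>n\<in>{r * b..<r * b + b}. 1 / real W)"
    proof (rule sum_mono)
      fix n assume "n \<in> {r * b..<r * b + b}"
      hence "n < W" using blk[OF q'(2)] by auto
      from F[OF this q'(3)] have "\<bar>if p then Re (F n i) else Im (F n i)\<bar> \<le> 1 / sqrt (real W)"
        using abs_Re_le_cmod[of "F n i"] abs_Im_le_cmod[of "F n i"] by auto
      hence "\<bar>if p then Re (F n i) else Im (F n i)\<bar>\<^sup>2 \<le> (1 / sqrt (real W))\<^sup>2"
        by (intro power_mono) auto
      thus "(if p then Re (F n i) else Im (F n i))\<^sup>2 \<le> 1 / real W" using W by (simp add: power_divide)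
    qed
    also have "\<dots> = 1 / real R" using Rb by (simp add: W_def)
    finally have "real (card (E q)) \<le> 2 * exp (- u\<^sup>2 / (2 * (1 / real R))) * 2 ^ W"
      unfolding E_def using Rb u by (intro rademacher_tail) auto
    also have "- u\<^sup>2 / (2 * (1 / real R)) = - (real 8 * ln (real W))" using Rb by (simp add: u)
    also have "exp (- (real 8 * ln (real W))) = 1 / real W ^ 8"
      unfolding exp_minus exp_of_nat_mult using W by (simp add: divide_inverse)
    finally show ?thesis by simp
  qed
  have sub: "{\<epsilon> \<in> signs W. \<exists>r<R. \<exists>i<W. cmod (\<Sum>n\<in>{r * b..<r * b + b}. of_real (\<epsilon> n) * F n i) > 8 * sqrt (ln (real W) / real R)}
     \<subseteq> (\<Union>q\<in>I. E q)"
  proof safe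
    fix \<epsilon> r i assume e: "\<epsilon> \<in> signs W" "r < R" "i < W"
      and gt: "cmod (\<Sum>n\<in>{r * b..<r * b + b}. of_real (\<epsilon> n) * F n i) > 8 * sqrt (ln (real W) / real R)"
    let ?e = "\<Sum>n\<in>{r * b..<r * b + b}. of_real (\<epsilon> n) * F n i"
    have "(\<Sum>n<W. \<epsilon> n * g (r, i, p) n) = (if p then Re ?e else Im ?e)" for p
    proof -
      have "(\<Sum>n<W. \<epsilon> n * g (r, i, p) n)
          = (\<Sum>n\<in>{r * b..<r * b + b}. \<epsilon> n * (if p then Re (F n i) else Im (F n i)))"
        by (rule sum.mono_neutral_cong_right) (use blk[OF e(2)] in \<open>auto simp: g_def\<close>)
      thus ?thesis by simp
    qed
    moreover have "\<bar>Re ?e\<bar> > u \<or> \<bar>Im ?e\<bar> > u"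
      using gt cmod_le[of ?e] unfolding u_def by linarith
    ultimately have "\<epsilon> \<in> E (r, i, True) \<or> \<epsilon> \<in> E (r, i, False)" using e by (simp add: E_def)
    thus "\<epsilon> \<in> (\<Union>q\<in>I. E q)" using e by (auto simp: I_def)
  qed
  have finI: "finite I" by (simp add: I_def)
  have "real (card {\<epsilon> \<in> signs W. \<exists>r<R. \<exists>i<W. cmod (\<Sum>n\<in>{r * b..<r * b + b}. of_real (\<epsilon> n) * F n i) > 8 * sqrt (ln (real W) / real R)})
     \<le> real (card (\<Union>q\<in>I. E q))"
    unfolding of_nat_le_iff by (rule card_mono[OF _ sub]) (auto simp: finI E_def)
  also have "\<dots> \<le> (\<Sum>q\<in>I. real (card (E q)))"
    unfolding of_nat_sum[symmetric] of_nat_le_iff by (rule card_UN_le[OF finI])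
  also have "\<dots> \<le> (\<Sum>q\<in>I. 2 / real W ^ 8 * 2 ^ W)" by (intro sum_mono tail)
  also have "\<dots> = (real R * real W * 2) * (2 / real W ^ 8 * 2 ^ W)"
    by (simp add: I_def card_cartesian_product)
  also have "\<dots> \<le> (real W * real W * 2) * (2 / real W ^ 8 * 2 ^ W)"
    using RW by (intro mult_right_mono) auto
  also have "\<dots> = 4 / real W ^ 6 * 2 ^ W" using W by (simp add: eval_nat_numeral)
  finally show ?thesis .
qed

text \<open>Truncation lets Markov's inequality give a bound of order \<open>1 / W\<^sup>2\<close>:
  above the threshold, the typical size of the Rademacher process is absorbed, and only rare events
  contribute to the truncated mean.\<close>

lemma demodulator_concentration:
  fixes F :: "nat \<Rightarrow> nat \<Rightarrow> complex" and R b K :: nat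
  defines "W \<equiv> R * b"
    and "L \<equiv> \<lambda>\<epsilon> r x. \<Sum>i<R * b. (\<Sum>n\<in>{r * b..<r * b + b}. complex_of_real (\<epsilon> n) * F n i) * x i"
    and "D \<equiv> {x. (\<Sum>i<R * b. (cmod (x i))\<^sup>2) \<le> 1 \<and> (\<Sum>i<R * b. cmod (x i)) \<le> 4 * sqrt (real K)}"
  assumes W: "W \<ge> 8" and K: "K > 0" "K \<le> W"
    and F: "\<And>n i. n < W \<Longrightarrow> i < W \<Longrightarrow> cmod (F n i) \<le> 1 / sqrt (real W)"
    and parseval: "\<And>x. (\<Sum>n<W. (cmod (\<Sum>i<W. F n i * x i))\<^sup>2) = (\<Sum>i<W. (cmod (x i))\<^sup>2)"
    and R: "real R \<ge> 10 ^ 12 * real K * ln (real W) ^ 6"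
  shows "real (card {\<epsilon> \<in> signs W. \<exists>x\<in>D. \<bar>(\<Sum>r<R. (cmod (L \<epsilon> r x))\<^sup>2) - (\<Sum>i<W. (cmod (x i))\<^sup>2)\<bar> > 3 / 8})
    \<le> 1024 / (real W)\<^sup>2 * 2 ^ W"
proof -
  define N where "N x = (\<Sum>i<W. (cmod (x i))\<^sup>2)" for x :: "nat \<Rightarrow> complex"
  define Z where "Z \<epsilon> r x = (cmod (L \<epsilon> r x))\<^sup>2" for \<epsilon> r x
  define T where "T \<epsilon> x = (\<Sum>r<R. Z \<epsilon> r x)" for \<epsilon> x
  define \<Psi> where "\<Psi> \<epsilon> = (SUP x\<in>D. \<bar>T \<epsilon> x - N x\<bar>)" for \<epsilon>
  define S where "S \<sigma> \<epsilon> = (SUP x\<in>D. \<bar>\<Sum>r<R. \<sigma> r * Z \<epsilon> r x\<bar>)" for \<sigma> \<epsilon>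
  define ent where "ent \<epsilon> r i = (\<Sum>n\<in>{r * b..<r * b + b}. complex_of_real (\<epsilon> n) * F n i)" for \<epsilon> r i
  have L: "L \<epsilon> r x = (\<Sum>i<W. ent \<epsilon> r i * x i)" for \<epsilon> r x by (simp add: L_def ent_def W_def)
  have D: "x \<in> D \<longleftrightarrow> N x \<le> 1 \<and> (\<Sum>i<W. cmod (x i)) \<le> 4 * sqrt (real K)" for x
    by (simp add: D_def N_def W_def)
  have W0: "real W > 0" using W by simp
  have Rb: "R > 0" "b > 0" using W by (auto simp: W_def intro: Nat.gr0I)
  have RW: "R \<le> W" and bW: "b \<le> W" using Rb by (auto simp: W_def)
  define l where "l = ln (real W)"
  have l: "l \<ge> 2" using exp_neg_square_ln_le(1)[OF W] by (simp add: l_def)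
  define s where "s = 4 * sqrt (real K)"
  define B where "B = 8 * sqrt (l / real R)"
  define q where "q = 1802 * (s * B) * l\<^sup>2"
  have s0: "s > 0" and B0: "B > 0" using K Rb l by (auto simp: s_def B_def)
  have D0: "(\<lambda>_. 0) \<in> D" by (simp add: D N_def)
  hence Dne: "D \<noteq> {}" by auto
  have blk: "{r * b..<r * b + b} \<subseteq> {..<W}" if "r < R" for r
  proof -
    have "Suc r * b \<le> R * b" using that by (intro mult_right_mono) auto
    thus ?thesis by (auto simp: W_def)
  qed
  \<comment> \<open>Written out, \<open>q\<^sup>2 = 1802\<^sup>2 * 1024 * K * l ^ 5 / R\<close>; the
    constant \<open>10 ^ 12\<close> in the lower bound for \<open>R\<close> brings this below
    \<open>1 / 256\<close>.\<close>
  have q2: "q\<^sup>2 \<le> 1 / 256"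
  proof -
    have "q\<^sup>2 = 1802\<^sup>2 * (s\<^sup>2 * B\<^sup>2) * l ^ 4" by (simp add: q_def power_mult_distrib flip: power_mult)
    also have "s\<^sup>2 = 16 * real K" by (simp add: s_def power_mult_distrib)
    also have "B\<^sup>2 = 64 * (l / real R)" using l Rb by (simp add: B_def power_mult_distrib)
    also have "1802\<^sup>2 * (16 * real K * (64 * (l / real R))) * l ^ 4 = 1802\<^sup>2 * 1024 * (real K * l ^ 5) / real R"
      by (simp add: eval_nat_numeral)
    also have "\<dots> \<le> 1 / 256"
    proof -
      have "real K * l ^ 5 * 1 \<le> real K * l ^ 5 * l" using l by (intro mult_left_mono) auto
      hence "10 ^ 12 * (real K * l ^ 5) \<le> real R"
        using R by (simp add: l_def eval_nat_numeral mult_ac)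
      thus ?thesis using Rb by (simp add: field_simps)
    qed
    finally show ?thesis .
  qed
  \<comment> \<open>A crude deterministic bound for use on exceptional events: entries are at most
    \<open>sqrt W\<close> and l1 norms at most \<open>4 * sqrt W\<close>, so each of the at most
    \<open>W\<close> rows contributes at most \<open>16 * W\<^sup>2\<close>. Failure probabilities
    of order \<open>W ^ (-5)\<close> and \<open>W ^ (-6)\<close> outweigh it.\<close>
  define C where "C = 16 * real W ^ 3"
  have C0: "C \<ge> 0" by (simp add: C_def)
  have Z0: "Z \<epsilon> r x \<ge> 0" for \<epsilon> r x by (simp add: Z_def)
  have N0: "N x \<ge> 0" for x by (simp add: N_def sum_nonneg)
  have bound: "T \<epsilon> x \<le> C" if e: "\<epsilon> \<in> signs W" and x: "x \<in> D" for \<epsilon> x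
  proof -
    have "Z \<epsilon> r x \<le> 16 * (real W)\<^sup>2" if r: "r < R" for r
    proof -
      have ent: "cmod (ent \<epsilon> r i) \<le> sqrt (real W)" if i: "i < W" for i
      proof -
        have "cmod (ent \<epsilon> r i) \<le> (\<Sum>n\<in>{r * b..<r * b + b}. cmod (complex_of_real (\<epsilon> n) * F n i))"
          unfolding ent_def by (rule norm_sum)
        also have "\<dots> \<le> (\<Sum>n\<in>{r * b..<r * b + b}. 1 / sqrt (real W))"
        proof (rule sum_mono)
          fix n assume "n \<in> {r * b..<r * b + b}"
          hence "n < W" using blk[OF r] by auto
          from F[OF this i] show "cmod (complex_of_real (\<epsilon> n) * F n i) \<le> 1 / sqrt (real W)"
            using signs_cases[OF e, of n] by (auto simp: norm_mult)
        qed
        also have "\<dots> = real b / sqrt (real W)" by simp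
        also have "\<dots> \<le> real W / sqrt (real W)" using bW by (intro divide_right_mono) auto
        also have "\<dots> = sqrt (real W)" by (simp add: real_div_sqrt)
        finally show ?thesis .
      qed
      have "cmod (L \<epsilon> r x) \<le> (\<Sum>i<W. cmod (ent \<epsilon> r i * x i))" unfolding L by (rule norm_sum)
      also have "\<dots> \<le> (\<Sum>i<W. sqrt (real W) * cmod (x i))"
        unfolding norm_mult by (intro sum_mono mult_right_mono ent) auto
      also have "\<dots> = sqrt (real W) * (\<Sum>i<W. cmod (x i))" by (simp add: sum_distrib_left)
      also have "\<dots> \<le> sqrt (real W) * (4 * sqrt (real W))"
      proof (rule mult_left_mono)
        have "sqrt (real K) \<le> sqrt (real W)" using K by simp
        thus "(\<Sum>i<W. cmod (x i)) \<le> 4 * sqrt (real W)" using x unfolding D by linarith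
      qed simp
      also have "\<dots> = 4 * real W" by simp
      finally have "(cmod (L \<epsilon> r x))\<^sup>2 \<le> (4 * real W)\<^sup>2" by (intro power_mono) auto
      thus ?thesis by (simp add: Z_def power_mult_distrib)
    qed
    hence "T \<epsilon> x \<le> (\<Sum>r<R. 16 * (real W)\<^sup>2)" unfolding T_def by (intro sum_mono) auto
    also have "\<dots> = real R * (16 * (real W)\<^sup>2)" by simp
    also have "\<dots> \<le> real W * (16 * (real W)\<^sup>2)" using RW by (intro mult_right_mono) auto
    also have "\<dots> = C" by (simp add: C_def eval_nat_numeral)
    finally show ?thesis .
  qed
  have T0: "T \<epsilon> x \<ge> 0" for \<epsilon> x by (simp add: T_def sum_nonneg Z0)
  \<comment> \<open>Distinct signs are uncorrelated, so only diagonal terms survive; the blocks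
    partition the indices, and Parseval's identity finishes.\<close>
  have mean: "(\<Sum>\<epsilon>\<in>signs W. T \<epsilon> x) = 2 ^ W * N x" for x
  proof -
    define f where "f n = (\<Sum>i<W. F n i * x i)" for n
    have Lf: "L \<epsilon> r x = (\<Sum>n\<in>{r * b..<r * b + b}. complex_of_real (\<epsilon> n) * f n)" for \<epsilon> r
      unfolding L ent_def f_def sum_distrib_left sum_distrib_right
      by (subst sum.swap) (simp add: mult_ac)
    have "(\<Sum>\<epsilon>\<in>signs W. T \<epsilon> x) = (\<Sum>r<R. \<Sum>\<epsilon>\<in>signs W. (cmod (\<Sum>n\<in>{r * b..<r * b + b}. complex_of_real (\<epsilon> n) * f n))\<^sup>2)"
      unfolding T_def Z_def Lf by (rule sum.swap)
    also have "\<dots> = (\<Sum>r<R. 2 ^ W * (\<Sum>n\<in>{r * b..<r * b + b}. (cmod (f n))\<^sup>2))"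
      by (intro sum.cong refl sum_signs_norm_square blk) auto
    also have "\<dots> = 2 ^ W * (\<Sum>n<R * b. (cmod (f n))\<^sup>2)"
      by (simp add: sum.nat_group flip: sum_distrib_left)
    also have "\<dots> = 2 ^ W * N x" using parseval[of x] by (simp add: f_def N_def W_def)
    finally show ?thesis .
  qed
  have local: "Z \<epsilon> r x = Z \<epsilon>' r x" if r: "r < R" and eq: "\<And>n. n div b = r \<Longrightarrow> \<epsilon> n = \<epsilon>' n" for \<epsilon> \<epsilon>' r x
  proof -
    have "ent \<epsilon> r i = ent \<epsilon>' r i" for i
      unfolding ent_def
    proof (rule sum.cong[OF refl])
      fix n assume n: "n \<in> {r * b..<r * b + b}"
      have "n div b = r" by (rule div_nat_eqI) (use n in \<open>auto simp: mult.commute\<close>)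
      thus "complex_of_real (\<epsilon> n) * F n i = complex_of_real (\<epsilon>' n) * F n i" using eq by simp
    qed
    thus ?thesis by (simp add: Z_def L)
  qed
  have bdd\<Psi>: "bdd_above ((\<lambda>x. \<bar>T \<epsilon> x - N x\<bar>) ` D)" if e: "\<epsilon> \<in> signs W" for \<epsilon>
  proof (rule bdd_aboveI2)
    fix x assume x: "x \<in> D"
    show "\<bar>T \<epsilon> x - N x\<bar> \<le> C + 1" using bound[OF e x] T0[of \<epsilon> x] N0[of x] C0 x unfolding D by linarith
  qed
  have \<Psi>_upper: "\<bar>T \<epsilon> x - N x\<bar> \<le> \<Psi> \<epsilon>" if "\<epsilon> \<in> signs W" "x \<in> D" for \<epsilon> x
    unfolding \<Psi>_def by (rule cSUP_upper[OF that(2) bdd\<Psi>[OF that(1)]])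
  have \<Psi>0: "\<Psi> \<epsilon> \<ge> 0" if "\<epsilon> \<in> signs W" for \<epsilon>
    using \<Psi>_upper[OF that D0] by linarith
  have S_le: "S \<sigma> \<epsilon> \<le> C" if e: "\<epsilon> \<in> signs W" and \<sigma>: "\<sigma> \<in> signs R" for \<sigma> \<epsilon>
    unfolding S_def
  proof (rule cSUP_least[OF Dne])
    fix x assume x: "x \<in> D"
    have "\<bar>\<Sum>r<R. \<sigma> r * Z \<epsilon> r x\<bar> \<le> (\<Sum>r<R. \<bar>\<sigma> r * Z \<epsilon> r x\<bar>)" by (rule sum_abs)
    also have "\<dots> = T \<epsilon> x" unfolding T_def
    proof (rule sum.cong[OF refl])
      show "\<bar>\<sigma> r * Z \<epsilon> r x\<bar> = Z \<epsilon> r x" for r using signs_cases[OF \<sigma>, of r] Z0[of \<epsilon> r x] by auto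
    qed
    finally show "\<bar>\<Sum>r<R. \<sigma> r * Z \<epsilon> r x\<bar> \<le> C" using bound[OF e x] by simp
  qed
  \<comment> \<open>Truncation happens at \<open>2 * t = 1 / 4\<close>, so a deviation above
    \<open>3 / 8 = 3 * t\<close> leaves \<open>P\<close> at least \<open>t\<close>, as Markov's
    inequality needs at the end.\<close>
  define t :: real where "t = 1 / 8"
  define P where "P \<epsilon> = max 0 (\<Psi> \<epsilon> - 2 * t)" for \<epsilon>
  have symm: "(\<Sum>\<epsilon>\<in>signs W. P \<epsilon>) \<le> 2 * (\<Sum>\<epsilon>\<in>signs W. max 0 (S \<sigma> \<epsilon> - t))" if \<sigma>: "\<sigma> \<in> signs R" for \<sigma>
    unfolding P_def \<Psi>_def S_def T_def W_def
    by (rule block_symmetrization[where C = C, OF local])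
       (use \<sigma> Rb Dne mean[unfolded T_def W_def] Z0 bound[unfolded T_def W_def] in \<open>auto simp: t_def\<close>)
  define Bad where "Bad = {\<epsilon> \<in> signs W. \<exists>r<R. \<exists>i<W. cmod (ent \<epsilon> r i) > B}"
  have card_Bad: "real (card Bad) \<le> 4 / real W ^ 6 * 2 ^ W"
    unfolding Bad_def ent_def B_def l_def W_def
    by (rule signed_block_sum_tail) (use Rb F in \<open>auto simp: W_def\<close>)
  have good: "(\<Sum>\<sigma>\<in>signs R. max 0 (S \<sigma> \<epsilon> - t)) \<le> 2 ^ R * (t / 4 * P \<epsilon> + C / real W ^ 5)"
    if e: "\<epsilon> \<in> signs W" "\<epsilon> \<notin> Bad" for \<epsilon>
  proof -
    \<comment> \<open>On \<open>D\<close> the squared norm \<open>N x\<close> is at most 1, so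
      \<open>M\<^sup>2 = 1 + \<Psi> \<epsilon>\<close> bounds \<open>T \<epsilon> x\<close>. Through
      \<open>M\<close> the deviation enters its own estimate.\<close>
    define M where "M = sqrt (1 + \<Psi> \<epsilon>)"
    have M: "M > 0" "M\<^sup>2 = 1 + \<Psi> \<epsilon>" using \<Psi>0[OF e(1)] by (auto simp: M_def)
    define A where "A = {\<sigma> \<in> signs R. \<exists>x\<in>D. \<bar>\<Sum>r<R. \<sigma> r * Z \<epsilon> r x\<bar> > q * M}"
    have cA: "real (card A) \<le> 2 ^ R / real W ^ 5"
      unfolding A_def q_def Z_def L l_def
    proof (rule rudelson_vershynin_tail[OF D0 _ s0 W _ RW])
      show "(\<Sum>i<W. cmod (x i)) \<le> s" if "x \<in> D" for x using that by (simp add: D s_def)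
      show "cmod (ent \<epsilon> r i) \<le> B" if "r < R" "i < W" for r i
        using e that unfolding Bad_def by (auto simp flip: not_less)
      show "(\<Sum>r<R. (cmod (\<Sum>i<W. ent \<epsilon> r i * x i))\<^sup>2) \<le> M\<^sup>2" if "x \<in> D" for x
      proof -
        have "T \<epsilon> x \<le> M\<^sup>2" using \<Psi>_upper[OF e(1) that] that M unfolding D by linarith
        thus ?thesis by (simp add: T_def Z_def L)
      qed
    qed (use Rb B0 M in auto)
    have "max 0 (S \<sigma> \<epsilon> - t) \<le> t / 4 * P \<epsilon> + (if \<sigma> \<in> A then C else 0)" if \<sigma>: "\<sigma> \<in> signs R" for \<sigma>
    proof (cases "\<sigma> \<in> A")
      case True
      have "0 \<le> t / 4 * P \<epsilon>" by (simp add: t_def P_def)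
      thus ?thesis using True S_le[OF e(1) \<sigma>] C0 by (simp add: t_def)
    next
      case False
      hence "S \<sigma> \<epsilon> \<le> q * M"
        unfolding S_def using \<sigma> by (intro cSUP_least[OF Dne]) (auto simp: A_def not_less)
      \<comment> \<open>Arithmetic-geometric mean inequality, weighted so that \<open>\<Psi>\<close>
        gets the coefficient \<open>1 / 32 = t / 4\<close>; the remaining constants fit below
        \<open>t\<close> because \<open>8 * q\<^sup>2 \<le> 1 / 32\<close>.\<close>
      also have "\<dots> \<le> M\<^sup>2 / 32 + 8 * q\<^sup>2"
        using zero_le_power2[of "M - 16 * q"] by (simp add: power2_eq_square algebra_simps)
      also have "\<dots> \<le> t / 4 * (\<Psi> \<epsilon> - 2 * t) + t"
      proof -
        have "t / 4 * (\<Psi> \<epsilon> - 2 * t) + t = (1 + \<Psi> \<epsilon>) / 32 + 11 / 128" by (simp add: t_def field_simps)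
        thus ?thesis using q2 unfolding M(2) by linarith
      qed
      also have "t / 4 * (\<Psi> \<epsilon> - 2 * t) \<le> t / 4 * P \<epsilon>"
        by (rule mult_left_mono) (auto simp: P_def t_def)
      finally have "S \<sigma> \<epsilon> - t \<le> t / 4 * P \<epsilon>" by simp
      moreover have "0 \<le> t / 4 * P \<epsilon>" by (simp add: t_def P_def)
      ultimately show ?thesis using False by (metis add_0_right max.boundedI)
    qed
    hence "(\<Sum>\<sigma>\<in>signs R. max 0 (S \<sigma> \<epsilon> - t)) \<le> (\<Sum>\<sigma>\<in>signs R. t / 4 * P \<epsilon> + (if \<sigma> \<in> A then C else 0))"
      by (intro sum_mono)
    also have "\<dots> = 2 ^ R * (t / 4 * P \<epsilon>) + real (card A) * C"
    proof -
      have "(\<Sum>\<sigma>\<in>signs R. if \<sigma> \<in> A then C else 0) = (\<Sum>\<sigma>\<in>A. C)"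
        by (rule sum.mono_neutral_cong_right) (auto simp: A_def)
      thus ?thesis by (simp add: sum.distrib)
    qed
    also have "\<dots> \<le> 2 ^ R * (t / 4 * P \<epsilon>) + 2 ^ R / real W ^ 5 * C"
      using cA C0 by (intro add_left_mono mult_right_mono) auto
    finally show ?thesis by (simp add: distrib_left)
  qed
  have bad: "(\<Sum>\<sigma>\<in>signs R. max 0 (S \<sigma> \<epsilon> - t)) \<le> 2 ^ R * C" if e: "\<epsilon> \<in> signs W" for \<epsilon>
  proof -
    have "(\<Sum>\<sigma>\<in>signs R. max 0 (S \<sigma> \<epsilon> - t)) \<le> (\<Sum>\<sigma>\<in>signs R. C)"
      using S_le[OF e] C0 by (intro sum_mono) (force simp: t_def)
    thus ?thesis by simp
  qed
  define Q where "Q = (\<Sum>\<epsilon>\<in>signs W. P \<epsilon>)"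
  have P0: "P \<epsilon> \<ge> 0" for \<epsilon> by (simp add: P_def)
  \<comment> \<open>Symmetrization holds for each fixed \<open>\<sigma>\<close>. Averaging over
    \<open>\<sigma>\<close> and exchanging the sums allows the tail bound to be used with
    \<open>\<epsilon>\<close>, and hence the rows, held fixed.\<close>
  have "2 ^ R * Q = (\<Sum>\<sigma>\<in>signs R. Q)" by simp
  also have "\<dots> \<le> (\<Sum>\<sigma>\<in>signs R. 2 * (\<Sum>\<epsilon>\<in>signs W. max 0 (S \<sigma> \<epsilon> - t)))"
    unfolding Q_def by (intro sum_mono symm)
  also have "\<dots> = 2 * (\<Sum>\<epsilon>\<in>signs W. \<Sum>\<sigma>\<in>signs R. max 0 (S \<sigma> \<epsilon> - t))"
    unfolding sum_distrib_left[symmetric] by (subst sum.swap) simp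
  also have "\<dots> \<le> 2 * (\<Sum>\<epsilon>\<in>signs W. 2 ^ R * (t / 4 * P \<epsilon> + C / real W ^ 5) + (if \<epsilon> \<in> Bad then 2 ^ R * C else 0))"
  proof (intro mult_left_mono sum_mono)
    fix \<epsilon> assume e: "\<epsilon> \<in> signs W"
    have "0 \<le> t / 4 * P \<epsilon> + C / real W ^ 5" using P0[of \<epsilon>] C0 by (simp add: t_def)
    hence "0 \<le> 2 ^ R * (t / 4 * P \<epsilon> + C / real W ^ 5)" by simp
    thus "(\<Sum>\<sigma>\<in>signs R. max 0 (S \<sigma> \<epsilon> - t))
        \<le> 2 ^ R * (t / 4 * P \<epsilon> + C / real W ^ 5) + (if \<epsilon> \<in> Bad then 2 ^ R * C else 0)"
      using good[OF e] bad[OF e] by auto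
  qed simp
  also have "\<dots> = 2 ^ R * (2 * (t / 4 * Q + 2 ^ W * (C / real W ^ 5) + real (card Bad) * C))"
  proof -
    have "(\<Sum>\<epsilon>\<in>signs W. if \<epsilon> \<in> Bad then 2 ^ R * C else 0) = (\<Sum>\<epsilon>\<in>Bad. 2 ^ R * C)"
      by (rule sum.mono_neutral_cong_right) (auto simp: Bad_def)
    moreover have "(\<Sum>\<epsilon>\<in>signs W. t / 4 * P \<epsilon> + C / real W ^ 5) = t / 4 * Q + 2 ^ W * (C / real W ^ 5)"
      unfolding Q_def sum.distrib sum_distrib_left[symmetric] by simp
    moreover have "(\<Sum>\<epsilon>\<in>signs W. 2 ^ R * (t / 4 * P \<epsilon> + C / real W ^ 5))
        = 2 ^ R * (\<Sum>\<epsilon>\<in>signs W. t / 4 * P \<epsilon> + C / real W ^ 5)"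
      by (rule sum_distrib_left[symmetric])
    ultimately have "(\<Sum>\<epsilon>\<in>signs W. 2 ^ R * (t / 4 * P \<epsilon> + C / real W ^ 5) + (if \<epsilon> \<in> Bad then 2 ^ R * C else 0))
        = 2 ^ R * (t / 4 * Q + 2 ^ W * (C / real W ^ 5)) + (\<Sum>\<epsilon>\<in>Bad. 2 ^ R * C)"
      by (simp only: sum.distrib[of "\<lambda>\<epsilon>. 2 ^ R * (t / 4 * P \<epsilon> + C / real W ^ 5)"])
    hence "2 * (\<Sum>\<epsilon>\<in>signs W. 2 ^ R * (t / 4 * P \<epsilon> + C / real W ^ 5) + (if \<epsilon> \<in> Bad then 2 ^ R * C else 0))
        = 2 * (2 ^ R * (t / 4 * Q + 2 ^ W * (C / real W ^ 5)) + (\<Sum>\<epsilon>\<in>Bad. 2 ^ R * C))"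
      by (rule arg_cong)
    also have "\<dots> = 2 ^ R * (2 * (t / 4 * Q + 2 ^ W * (C / real W ^ 5) + real (card Bad) * C))"
      by (simp add: algebra_simps)
    finally show ?thesis .
  qed
  finally have "Q \<le> 2 * (t / 4 * Q + 2 ^ W * (C / real W ^ 5) + real (card Bad) * C)"
    by (rule mult_left_le_imp_le) simp
  moreover have "Q \<ge> 0" unfolding Q_def by (intro sum_nonneg P0)
  \<comment> \<open>On the right \<open>Q\<close> has the coefficient
    \<open>2 * (t / 4) = 1 / 16\<close> and is absorbed by the left side.\<close>
  ultimately have "Q \<le> 4 * (2 ^ W * (C / real W ^ 5) + real (card Bad) * C)" by (simp add: t_def)
  also have "\<dots> \<le> 4 * (2 ^ W * (C / real W ^ 5) + 4 / real W ^ 6 * 2 ^ W * C)"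
    using card_Bad C0 by (intro mult_left_mono add_left_mono mult_right_mono) auto
  also have "\<dots> = 64 * 2 ^ W * (1 / (real W)\<^sup>2 + 4 / real W ^ 3)"
    using W0 by (simp add: C_def eval_nat_numeral field_simps)
  also have "\<dots> \<le> 64 * 2 ^ W * (2 / (real W)\<^sup>2)"
  proof (rule mult_left_mono)
    have "4 / real W ^ 3 = 4 / real W * (1 / (real W)\<^sup>2)" by (simp add: eval_nat_numeral)
    also have "\<dots> \<le> 1 * (1 / (real W)\<^sup>2)" using W by (intro mult_right_mono) auto
    finally show "1 / (real W)\<^sup>2 + 4 / real W ^ 3 \<le> 2 / (real W)\<^sup>2" by simp
  qed simp
  finally have Q: "Q \<le> 128 / (real W)\<^sup>2 * 2 ^ W" by simp
  define E where "E = {\<epsilon> \<in> signs W. \<exists>x\<in>D. \<bar>T \<epsilon> x - N x\<bar> > 3 / 8}"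
  have "real (card E) * t = (\<Sum>\<epsilon>\<in>E. t)" by simp
  also have "\<dots> \<le> (\<Sum>\<epsilon>\<in>E. P \<epsilon>)"
  proof (rule sum_mono)
    fix \<epsilon> assume "\<epsilon> \<in> E"
    then obtain x where "\<epsilon> \<in> signs W" "x \<in> D" "\<bar>T \<epsilon> x - N x\<bar> > 3 / 8" by (auto simp: E_def)
    with \<Psi>_upper[of \<epsilon> x] show "t \<le> P \<epsilon>" by (simp add: P_def t_def)
  qed
  also have "\<dots> \<le> Q" unfolding Q_def by (rule sum_mono2) (auto simp: E_def P0)
  finally have "real (card E) \<le> 1024 / (real W)\<^sup>2 * 2 ^ W" using Q by (simp add: t_def)
  thus ?thesis by (simp add: E_def T_def Z_def N_def)
qed

section \<open>The demodulator matrix and recovery\<close>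

lemma norm_fourier_mat:
  assumes "n < W" "i < W"
  shows "cmod (fourier_mat W $$ (n, i)) = 1 / sqrt (real W)"
proof -
  have "Re (- 2 * complex_of_real pi * \<i> * of_nat n * of_int (freq W i) / of_nat W) = 0"
    by (simp add: Re_divide)
  thus ?thesis using assms by (simp add: fourier_mat_def norm_divide norm_exp_eq_Re)
qed

text \<open>The frequency offset cancels in \<open>freq W i - freq W j = i - j\<close>, so the inner
  product of two columns is a geometric sum over a \<open>W\<close>-th root of unity
  \<open>\<zeta>\<close>. For distinct columns \<open>\<zeta> \<noteq> 1\<close>, since
  \<open>W\<close> cannot divide a nonzero number smaller than itself in absolute value.\<close>

lemma fourier_mat_orthonormal:
  assumes "i < W" "j < W"
  shows "(\<Sum>n<W. fourier_mat W $$ (n, i) * cnj (fourier_mat W $$ (n, j))) = (if i = j then 1 else 0)"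
proof -
  define \<zeta> where "\<zeta> = exp (- 2 * complex_of_real pi * \<i> * of_int (int i - int j) / of_nat W)"
  have W: "W > 0" using assms by simp
  have sq: "complex_of_real (sqrt (real W)) * complex_of_real (sqrt (real W)) = of_nat W"
    unfolding of_real_mult[symmetric] by simp
  have summand: "fourier_mat W $$ (n, i) * cnj (fourier_mat W $$ (n, j)) = \<zeta> ^ n / of_nat W" if n: "n < W" for n
  proof -
    define \<theta> where "\<theta> i = - 2 * complex_of_real pi * \<i> * of_nat n * of_int (freq W i) / of_nat W" for i
    have "exp (\<theta> i) * cnj (exp (\<theta> j)) = exp (\<theta> i - \<theta> j)"
      unfolding exp_cnj exp_add[symmetric] by (simp add: \<theta>_def)
    also have "\<theta> i - \<theta> j = of_nat n * (- 2 * complex_of_real pi * \<i> * of_int (int i - int j) / of_nat W)"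
      unfolding \<theta>_def diff_divide_distrib[symmetric] by (simp add: freq_def algebra_simps)
    also have "exp \<dots> = \<zeta> ^ n" unfolding \<zeta>_def exp_of_nat_mult ..
    finally have "exp (\<theta> i) * cnj (exp (\<theta> j)) = \<zeta> ^ n" .
    moreover have "fourier_mat W $$ (n, k) = exp (\<theta> k) / complex_of_real (sqrt (real W))" if "k < W" for k
      using that n by (simp add: fourier_mat_def \<theta>_def)
    ultimately have "fourier_mat W $$ (n, i) * cnj (fourier_mat W $$ (n, j))
        = (exp (\<theta> i) * cnj (exp (\<theta> j))) / (complex_of_real (sqrt (real W)) * complex_of_real (sqrt (real W)))"
      using assms by simp
    thus ?thesis unfolding \<open>exp (\<theta> i) * cnj (exp (\<theta> j)) = \<zeta> ^ n\<close> sq .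
  qed
  have sum_eq: "(\<Sum>n<W. fourier_mat W $$ (n, i) * cnj (fourier_mat W $$ (n, j))) = (\<Sum>n<W. \<zeta> ^ n) / of_nat W"
    unfolding sum_divide_distrib by (intro sum.cong refl summand) simp
  show ?thesis
  proof (cases "i = j")
    case True
    thus ?thesis unfolding sum_eq using W by (simp add: \<zeta>_def)
  next
    case False
    have ne: "\<zeta> \<noteq> 1"
    proof
      assume "\<zeta> = 1"
      then obtain m :: int where "Im (- 2 * complex_of_real pi * \<i> * of_int (int i - int j) / of_nat W) = of_int (2 * m) * pi"
        unfolding \<zeta>_def exp_eq_1 by auto
      hence "- 2 * pi * real_of_int (int i - int j) / real W = 2 * real_of_int m * pi"
        by (simp add: Im_divide_of_nat)
      hence "pi * (- real_of_int (int i - int j)) = pi * (real_of_int m * real W)"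
        using W by (simp add: field_simps)
      hence "- real_of_int (int i - int j) = real_of_int m * real W" by simp
      hence "real_of_int (- (int i - int j)) = real_of_int (m * int W)" by simp
      hence "- (int i - int j) = m * int W" unfolding of_int_eq_iff .
      hence "int i - int j = int W * (- m)" by (simp add: algebra_simps)
      hence "int W dvd int i - int j" by (simp only: dvd_triv_left)
      moreover have "\<bar>int i - int j\<bar> < \<bar>int W\<bar>" using assms by linarith
      ultimately have "int i - int j = 0" using dvd_imp_le_int not_less by blast
      thus False using False by simp
    qed
    have "\<zeta> ^ W = exp (of_nat W * (- 2 * complex_of_real pi * \<i> * of_int (int i - int j) / of_nat W))"
      unfolding \<zeta>_def exp_of_nat_mult ..
    also have "of_nat W * (- 2 * complex_of_real pi * \<i> * of_int (int i - int j) / of_nat W)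
        = 0 + \<i> * (of_int (int j - int i) * (complex_of_real pi * 2))"
      using W by (simp add: field_simps)
    also have "exp \<dots> = 1" unfolding exp_plus_2pin by simp
    finally have "(\<Sum>n<W. \<zeta> ^ n) = 0" unfolding geometric_sum[OF ne] by simp
    thus ?thesis unfolding sum_eq using False by simp
  qed
qed

lemma fourier_mat_parseval:
  "(\<Sum>n<W. (cmod (\<Sum>i<W. fourier_mat W $$ (n, i) * x i))\<^sup>2) = (\<Sum>i<W. (cmod (x i))\<^sup>2)"
proof -
  let ?F = "\<lambda>n i. fourier_mat W $$ (n, i)"
  have "complex_of_real (\<Sum>n<W. (cmod (\<Sum>i<W. ?F n i * x i))\<^sup>2)
      = (\<Sum>n<W. \<Sum>i<W. \<Sum>j<W. (?F n i * cnj (?F n j)) * (x i * cnj (x j)))"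
    unfolding of_real_sum complex_norm_square by (simp add: sum_product mult_ac)
  also have "\<dots> = (\<Sum>i<W. \<Sum>j<W. (\<Sum>n<W. ?F n i * cnj (?F n j)) * (x i * cnj (x j)))"
    unfolding sum_distrib_right by (subst sum.swap, rule sum.cong[OF refl], rule sum.swap)
  also have "\<dots> = (\<Sum>i<W. \<Sum>j<W. if i = j then x i * cnj (x i) else 0)"
    by (intro sum.cong refl) (auto simp: fourier_mat_orthonormal)
  also have "\<dots> = complex_of_real (\<Sum>i<W. (cmod (x i))\<^sup>2)"
    unfolding of_real_sum complex_norm_square by simp
  finally show ?thesis unfolding of_real_eq_iff .
qed

text \<open>Row \<open>r\<close> of the sampling matrix selects the block of length
  \<open>W div R = b\<close> starting at \<open>r * b\<close>. This brings the matrix into the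
  blockwise form of \<open>demodulator_concentration\<close>.\<close>

lemma demodulator_mat_mult_vec:
  assumes r: "r < R"
  shows "(demodulator_mat R (R * b) \<epsilon> *\<^sub>v vec (R * b) x) $ r
    = (\<Sum>i<R * b. (\<Sum>n\<in>{r * b..<r * b + b}. complex_of_real (\<epsilon> n) * fourier_mat (R * b) $$ (n, i)) * x i)"
proof -
  define W where "W = R * b"
  have F: "fourier_mat W \<in> carrier_mat W W" by (simp add: fourier_mat_def)
  have div: "W div R = b" using r by (simp add: W_def)
  have "Suc r * b \<le> R * b" using r by (intro mult_right_mono) auto
  hence blk: "{r * b..<r * b + b} \<subseteq> {..<W}" by (auto simp: W_def)
  have H: "sampling_mat R W \<in> carrier_mat R W" by (simp add: sampling_mat_def)
  have entry: "demodulator_mat R W \<epsilon> $$ (r, i)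
      = (\<Sum>n\<in>{r * b..<r * b + b}. complex_of_real (\<epsilon> n) * fourier_mat W $$ (n, i))" if i: "i < W" for i
  proof -
    have "demodulator_mat R W \<epsilon> $$ (r, i)
        = (\<Sum>n<W. (if r * b \<le> n \<and> n < (r + 1) * b then 1 else 0) * complex_of_real (\<epsilon> n) * fourier_mat W $$ (n, i))"
      unfolding demodulator_mat_def sign_mat_def mat_diag_mult_right[OF H]
      using r i F H div
      by (simp add: scalar_prod_def sampling_mat_def atLeast0LessThan)
    also have "\<dots> = (\<Sum>n\<in>{r * b..<r * b + b}. complex_of_real (\<epsilon> n) * fourier_mat W $$ (n, i))"
      by (rule sum.mono_neutral_cong_right) (use blk in \<open>auto simp: algebra_simps\<close>)
    finally show ?thesis .
  qed
  have dims: "dim_row (demodulator_mat R W \<epsilon>) = R" "dim_col (demodulator_mat R W \<epsilon>) = W"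
    by (simp_all add: demodulator_mat_def sampling_mat_def fourier_mat_def)
  have "(demodulator_mat R W \<epsilon> *\<^sub>v vec W x) $ r = (\<Sum>i<W. demodulator_mat R W \<epsilon> $$ (r, i) * x i)"
    using r dims by (simp add: scalar_prod_def atLeast0LessThan)
  also have "\<dots> = (\<Sum>i<W. (\<Sum>n\<in>{r * b..<r * b + b}. complex_of_real (\<epsilon> n) * fourier_mat W $$ (n, i)) * x i)"
    by (intro sum.cong refl) (simp add: entry)
  finally show ?thesis by (simp add: W_def)
qed

section \<open>Stable recovery by l1 minimization\<close>

lemma l2_norm_square: "(l2_norm v)\<^sup>2 = (\<Sum>i<dim_vec v. (cmod (v $ i))\<^sup>2)"
  by (simp add: l2_norm_def L2_set_def sum_nonneg)

lemma l2_norm_nonneg: "l2_norm v \<ge> 0"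
  by (simp add: l2_norm_def L2_set_nonneg)

lemma l2_norm_triangle:
  assumes "v \<in> carrier_vec n" "w \<in> carrier_vec n"
  shows "l2_norm (v + w) \<le> l2_norm v + l2_norm w"
proof -
  have "l2_norm (v + w) = L2_set (\<lambda>i. cmod (v $ i + w $ i)) {..<n}"
    unfolding l2_norm_def using assms by (intro L2_set_cong) auto
  also have "\<dots> \<le> L2_set (\<lambda>i. cmod (v $ i) + cmod (w $ i)) {..<n}"
    by (intro L2_set_mono norm_triangle_ineq) simp
  also have "\<dots> \<le> l2_norm v + l2_norm w"
    using assms L2_set_triangle_ineq[of "\<lambda>i. cmod (v $ i)" "\<lambda>i. cmod (w $ i)" "{..<n}"]
    by (simp add: l2_norm_def)
  finally show ?thesis .
qed

text \<open>If the \<open>\<ell>\<^sub>1\<close> tail is dominated by \<open>sqrt K * l2_norm h\<close>, then the normalized error \<open>h\<close> lies in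
  the set on which \<open>A\<close> is nearly isometric; otherwise the tail itself bounds the error.\<close>

lemma l1_recovery:
  fixes A :: "complex mat" and K :: nat
  assumes A: "A \<in> carrier_mat R W" and K: "K > 0"
    and isom: "\<And>x. (\<Sum>i<W. (cmod (x i))\<^sup>2) \<le> 1 \<Longrightarrow> (\<Sum>i<W. cmod (x i)) \<le> 4 * sqrt (real K) \<Longrightarrow>
        \<bar>(\<Sum>r<R. (cmod ((A *\<^sub>v vec W x) $ r))\<^sup>2) - (\<Sum>i<W. (cmod (x i))\<^sup>2)\<bar> \<le> 3 / 8"
    and s: "s \<in> carrier_vec W" and \<nu>: "\<nu> \<in> carrier_vec R" "l2_norm \<nu> \<le> \<eta>"
    and min: "l1_minimizer A (A *\<^sub>v s + \<nu>) \<eta> z" and best: "best_sparse_approx K s sK"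
  shows "l2_norm (z - s) \<le> 4 * max \<eta> (l1_norm (s - sK) / sqrt (real K))"
proof -
  define h where "h = z - s"
  have z: "z \<in> carrier_vec W" "l2_norm (A *\<^sub>v z - (A *\<^sub>v s + \<nu>)) \<le> \<eta>"
    using min A by (auto simp: l1_minimizer_def is_arg_min_def)
  have As: "A *\<^sub>v s \<in> carrier_vec R" "A *\<^sub>v z \<in> carrier_vec R" using A s z by auto
  have \<eta>: "\<eta> \<ge> 0" using \<nu> l2_norm_nonneg[of \<nu>] by linarith
  \<comment> \<open>The true vector is feasible, its residual being the noise, so the minimizer has
    no larger l1 norm.\<close>
  have "l2_norm (A *\<^sub>v s - (A *\<^sub>v s + \<nu>)) = l2_norm \<nu>"
    using As \<nu> by (auto simp: l2_norm_def L2_set_def intro!: sum.cong)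
  hence "l1_norm z \<le> l1_norm s"
    using min A s \<nu> by (auto simp: l1_minimizer_def is_arg_min_def not_less)
  moreover have "sK \<in> carrier_vec W" "sparse K sK"
    using best s by (auto simp: best_sparse_approx_def is_arg_min_def)
  moreover define T where "T = {i. i < W \<and> sK $ i \<noteq> 0}"
  ultimately have sK: "sK \<in> carrier_vec W" "card T \<le> K" and zs: "l1_norm z \<le> l1_norm s"
    by (auto simp: sparse_def)
  have h: "h \<in> carrier_vec W" using z s by (simp add: h_def)
  define \<tau> where "\<tau> = l1_norm (s - sK)"
  define H where "H = l2_norm h"
  have H0: "H \<ge> 0" by (simp add: H_def l2_norm_nonneg)
  have H2: "H\<^sup>2 = (\<Sum>i<W. (cmod (h $ i))\<^sup>2)" using h by (simp add: H_def l2_norm_square)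
  \<comment> \<open>The usual cone inequality, summed from pointwise triangle inequalities: off the
    support \<open>T\<close> of \<open>sK\<close>, the entry of \<open>s\<close> is itself part of
    the tail, and on \<open>T\<close> Cauchy-Schwarz gives \<open>sqrt K\<close>.\<close>
  have cone: "(\<Sum>i<W. cmod (h $ i)) \<le> 2 * sqrt (real K) * H + 2 * \<tau>"
  proof -
    have "(\<Sum>i<W. cmod (h $ i) - 2 * (if i \<in> T then cmod (h $ i) else 0) - 2 * cmod (s $ i - sK $ i))
        \<le> (\<Sum>i<W. cmod (z $ i) - cmod (s $ i))"
    proof (rule sum_mono)
      fix i assume "i \<in> {..<W}"
      hence i: "i < W" by simp
      have hi: "h $ i = z $ i - s $ i" using i z s by (simp add: h_def)
      have 1: "cmod (s $ i) \<le> cmod (z $ i) + cmod (h $ i)" and 2: "cmod (h $ i) \<le> cmod (z $ i) + cmod (s $ i)"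
        unfolding hi using norm_triangle_sub[of "s $ i" "z $ i"] norm_triangle_ineq4[of "z $ i" "s $ i"]
        by (simp_all add: norm_minus_commute)
      show "cmod (h $ i) - 2 * (if i \<in> T then cmod (h $ i) else 0) - 2 * cmod (s $ i - sK $ i)
          \<le> cmod (z $ i) - cmod (s $ i)"
      proof (cases "i \<in> T")
        case True
        have "0 \<le> cmod (s $ i - sK $ i)" by simp
        thus ?thesis using 1 unfolding if_P[OF True] by linarith
      next
        case False
        hence "sK $ i = 0" using i by (simp add: T_def)
        thus ?thesis using False 2 by simp
      qed
    qed
    also have "\<dots> \<le> 0" using zs z s by (simp add: l1_norm_def sum_subtractf)
    finally have "(\<Sum>i<W. cmod (h $ i)) \<le> 2 * (\<Sum>i<W. if i \<in> T then cmod (h $ i) else 0) + 2 * \<tau>"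
      using s sK by (simp add: sum_subtractf \<tau>_def l1_norm_def flip: sum_distrib_left)
    also have "(\<Sum>i<W. if i \<in> T then cmod (h $ i) else 0) = (\<Sum>i\<in>T. cmod (h $ i))"
      by (rule sum.mono_neutral_cong_right) (auto simp: T_def)
    also have "(\<Sum>i\<in>T. cmod (h $ i)) \<le> sqrt (real K) * H"
    proof (rule power2_le_imp_le)
      have "(\<Sum>i\<in>T. cmod (h $ i))\<^sup>2 \<le> (\<Sum>i\<in>T. (cmod (h $ i))\<^sup>2) * real (card T)"
        by (rule sum_squared_le_sum_of_squares)
      also have "\<dots> \<le> H\<^sup>2 * real K"
        unfolding H2 using sK by (intro mult_mono sum_mono2) (auto simp: T_def sum_nonneg)
      finally show "(\<Sum>i\<in>T. cmod (h $ i))\<^sup>2 \<le> (sqrt (real K) * H)\<^sup>2" by (simp add: power_mult_distrib mult.commute)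
    qed (use H0 in simp)
    finally show ?thesis by simp
  qed
  have "H \<le> 4 * max \<eta> (\<tau> / sqrt (real K))"
  proof (cases "\<tau> \<le> sqrt (real K) * H \<and> H > 0")
    case False
    have "0 \<le> \<tau>" by (simp add: \<tau>_def l1_norm_def sum_nonneg)
    hence "H \<le> \<tau> / sqrt (real K)" using False K H0 by (auto simp: field_simps)
    thus ?thesis using \<open>0 \<le> \<tau>\<close> \<eta> by (auto simp: max_def)
  next
    case True
    \<comment> \<open>In this case \<open>\<tau> \<le> sqrt K * H\<close>, so after division by
      \<open>H\<close> the cone bound becomes \<open>2 * sqrt K + 2 * sqrt K\<close>, the radius in
      \<open>isom\<close>.\<close>
    define x where "x i = h $ i / of_real H" for i
    have Ah: "A *\<^sub>v h = (A *\<^sub>v z - (A *\<^sub>v s + \<nu>)) + \<nu>"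
      unfolding h_def mult_minus_distrib_mat_vec[OF A z(1) s] using As \<nu> A by (intro eq_vecI) auto
    have "l2_norm (A *\<^sub>v h) \<le> \<eta> + \<eta>"
      unfolding Ah by (rule order_trans[OF l2_norm_triangle[of _ R]]) (use As \<nu> z in auto)
    hence "(l2_norm (A *\<^sub>v h))\<^sup>2 \<le> (2 * \<eta>)\<^sup>2" by (intro power_mono) (auto simp: l2_norm_nonneg)
    moreover have "(l2_norm (A *\<^sub>v h))\<^sup>2 = (\<Sum>r<R. (cmod ((A *\<^sub>v h) $ r))\<^sup>2)" using A by (simp add: l2_norm_square)
    ultimately have Ah2: "(\<Sum>r<R. (cmod ((A *\<^sub>v h) $ r))\<^sup>2) \<le> 4 * \<eta>\<^sup>2" by (simp add: power_mult_distrib)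
    have x2: "(\<Sum>i<W. (cmod (x i))\<^sup>2) = 1"
      using True by (simp add: x_def norm_divide power_divide flip: sum_divide_distrib H2)
    have "(\<Sum>i<W. cmod (x i)) = (\<Sum>i<W. cmod (h $ i)) / H"
      using True by (simp add: x_def norm_divide flip: sum_divide_distrib)
    also have "\<dots> \<le> 4 * sqrt (real K)"
      using cone True by (simp add: divide_le_eq)
    finally have x1: "(\<Sum>i<W. cmod (x i)) \<le> 4 * sqrt (real K)" .
    have "(A *\<^sub>v vec W x) $ r = (A *\<^sub>v h) $ r / of_real H" if "r < R" for r
      using A h that by (simp add: scalar_prod_def x_def sum_divide_distrib)
    hence "(\<Sum>r<R. (cmod ((A *\<^sub>v vec W x) $ r))\<^sup>2) = (\<Sum>r<R. (cmod ((A *\<^sub>v h) $ r))\<^sup>2) / H\<^sup>2"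
      using True by (simp add: norm_divide power_divide sum_divide_distrib)
    with isom[OF _ x1] x2 have "\<bar>(\<Sum>r<R. (cmod ((A *\<^sub>v h) $ r))\<^sup>2) / H\<^sup>2 - 1\<bar> \<le> 3 / 8" by simp
    \<comment> \<open>The lower isometry bound meets \<open>l2_norm (A h) \<le> 2 * \<eta>\<close>:
      the squared error is at most \<open>32 / 5\<close> times \<open>\<eta>\<^sup>2\<close>, below
      \<open>16 * \<eta>\<^sup>2\<close>.\<close>
    hence "5 / 8 \<le> (\<Sum>r<R. (cmod ((A *\<^sub>v h) $ r))\<^sup>2) / H\<^sup>2" by linarith
    also have "\<dots> \<le> 4 * \<eta>\<^sup>2 / H\<^sup>2" by (intro divide_right_mono Ah2) auto
    finally have "H\<^sup>2 * 5 \<le> 32 * \<eta>\<^sup>2" using True by (simp add: field_simps)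
    moreover have "0 \<le> \<eta>\<^sup>2" "(4 * \<eta>)\<^sup>2 = 16 * \<eta>\<^sup>2" by (simp_all add: power_mult_distrib)
    ultimately have "H\<^sup>2 \<le> (4 * \<eta>)\<^sup>2" by linarith
    hence "H \<le> 4 * \<eta>" by (rule power2_le_imp_le) (use \<eta> in simp)
    thus ?thesis by (auto simp: max_def)
  qed
  thus ?thesis by (simp add: H_def h_def \<tau>_def)
qed

theorem theorem2:
  shows "\<exists>C1 C2 C3 :: real. C1 > 0 \<and> C2 > 0 \<and> C3 > 0 \<and>
    (\<forall>W K R :: nat.
       W > 0 \<and> even W \<and> K > 0 \<and> K \<le> W \<and> R > 0 \<and> R dvd W \<and>
       real R \<ge> C1 * real K * ln (real W) ^ 6 \<longrightarrow>
       measure_pmf.prob (sign_pmf W)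
         {\<epsilon>. \<not> (\<forall>s \<in> carrier_vec W. \<forall>\<eta> \<ge> 0. \<forall>\<nu> \<in> carrier_vec R. l2_norm \<nu> \<le> \<eta> \<longrightarrow>
               (\<forall>s_hat sK.
                  l1_minimizer (demodulator_mat R W \<epsilon>) (demodulator_mat R W \<epsilon> *\<^sub>v s + \<nu>) \<eta> s_hat \<and>
                  best_sparse_approx K s sK \<longrightarrow>
                  l2_norm (s_hat - s) \<le> C3 * max \<eta> (l1_norm (s - sK) / sqrt (real K))))}
       \<le> C2 / real W)"
proof (rule exI[of _ "10 ^ 12"], rule exI[of _ 1024], rule exI[of _ 4], intro conjI allI impI)
  fix W K R :: nat
  assume asm: "W > 0 \<and> even W \<and> K > 0 \<and> K \<le> W \<and> R > 0 \<and> R dvd W \<and> real R \<ge> 10 ^ 12 * real K * ln (real W) ^ 6"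
  then obtain b where Wb: "W = R * b" by auto
  let ?E = "{\<epsilon>. \<not> (\<forall>s \<in> carrier_vec W. \<forall>\<eta> \<ge> 0. \<forall>\<nu> \<in> carrier_vec R. l2_norm \<nu> \<le> \<eta> \<longrightarrow>
               (\<forall>s_hat sK.
                  l1_minimizer (demodulator_mat R W \<epsilon>) (demodulator_mat R W \<epsilon> *\<^sub>v s + \<nu>) \<eta> s_hat \<and>
                  best_sparse_approx K s sK \<longrightarrow>
                  l2_norm (s_hat - s) \<le> 4 * max \<eta> (l1_norm (s - sK) / sqrt (real K))))}"
  show "measure_pmf.prob (sign_pmf W) ?E \<le> 1024 / real W"
  \<comment> \<open>For \<open>W < 8\<close> the claimed probability bound exceeds 1; otherwise the
    concentration estimate applies.\<close>
  proof (cases "W \<ge> 8")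
    case False
    hence "1 \<le> 1024 / real W" using asm by (simp add: field_simps)
    thus ?thesis using measure_pmf.prob_le_1 order_trans by blast
  next
    case True
    define B where "B = {\<epsilon> \<in> signs W. \<exists>x\<in>{x. (\<Sum>i<W. (cmod (x i))\<^sup>2) \<le> 1 \<and> (\<Sum>i<W. cmod (x i)) \<le> 4 * sqrt (real K)}.
       \<bar>(\<Sum>r<R. (cmod (\<Sum>i<W. (\<Sum>n\<in>{r * b..<r * b + b}. complex_of_real (\<epsilon> n) * fourier_mat W $$ (n, i)) * x i))\<^sup>2)
         - (\<Sum>i<W. (cmod (x i))\<^sup>2)\<bar> > 3 / 8}"
    have B: "real (card B) \<le> 1024 / (real W)\<^sup>2 * 2 ^ W"
      unfolding B_def Wb
    proof (rule demodulator_concentration)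
      show "cmod (fourier_mat (R * b) $$ (n, i)) \<le> 1 / sqrt (real (R * b))" if "n < R * b" "i < R * b" for n i
        using norm_fourier_mat[OF that] by simp
    qed (use asm True Wb fourier_mat_parseval in auto)
    \<comment> \<open>Recovery is deterministic once the near-isometry holds, so uniformity in
      \<open>s\<close>, \<open>\<eta>\<close> and \<open>\<nu>\<close> costs no further
      probability.\<close>
    have "signs W \<inter> ?E \<subseteq> B"
    proof (rule subsetI, rule ccontr)
      fix \<epsilon> assume e: "\<epsilon> \<in> signs W \<inter> ?E" "\<epsilon> \<notin> B"
      have isom: "\<bar>(\<Sum>r<R. (cmod ((demodulator_mat R W \<epsilon> *\<^sub>v vec W x) $ r))\<^sup>2) - (\<Sum>i<W. (cmod (x i))\<^sup>2)\<bar> \<le> 3 / 8"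
        if "(\<Sum>i<W. (cmod (x i))\<^sup>2) \<le> 1" "(\<Sum>i<W. cmod (x i)) \<le> 4 * sqrt (real K)" for x
        using e that by (auto simp: B_def Wb demodulator_mat_mult_vec not_less)
      have A: "demodulator_mat R W \<epsilon> \<in> carrier_mat R W"
        by (auto simp: demodulator_mat_def sampling_mat_def fourier_mat_def)
      have "\<epsilon> \<notin> ?E" using l1_recovery[OF A _ isom] asm by blast
      thus False using e by blast
    qed
    moreover have "finite B" by (simp add: B_def)
    ultimately have "real (card (signs W \<inter> ?E)) \<le> real (card B)" by (simp add: card_mono)
    hence "measure_pmf.prob (sign_pmf W) ?E \<le> 1024 / (real W)\<^sup>2"
      unfolding sign_pmf_eq using B by (simp add: measure_pmf_of_set divide_le_eq)
    also have "\<dots> \<le> 1024 / real W" using True by (intro divide_left_mono) (auto simp: power2_eq_square)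
    finally show ?thesis .
  qed
qed auto

end
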